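(* Let $n\ge 2$, let $f\colon\Gamma\to G$ be a group homomorphism, and let $p\colon\widetilde G\to G$ be an $f$-extension. \begin{enumerate} \item If $\ker p\subseteq Z_{n-1}(\widetilde G)$, then there is an epimorphism $G_f^{\otimes n}\longrightarrow\gamma_n(\widetilde G)$. \item If $\ker p\subseteq\mathfrak D_{n-1}(\widetilde G)$, then there is an epimorphism $G_f^{\wedge(n)}\longrightarrow\Gamma_n(\widetilde G)$. \end{enumerate}
   Context: An $f$-extension of $G$, for $f\colon\Gamma\to G$, is an epimorphism $p\colon\widetilde G\to G$ for which there is a homomorphism $\widetilde f\colon\Gamma\to\widetilde G$ with $p\widetilde f=f$. Write $[x,y]=xyx^{-1}y^{-1}$, ${}^{x}y=xyx^{-1}$. $Z_k(G)$ is the $k$-th term of the upper central series ($Z_0=1$, $Z_1=Z(G)$). Lower central series: $\gamma_1(G)=G$, $\gamma_{k+1}(G)=[\gamma_k(G),G]$. Derived series: $\Gamma_1(G)=G$, $\Gamma_{k+1}(G)=[\Gamma_k(G),\Gamma_k(G)]$. For $k\ge1$, $\mathfrak D_k(G)$ is the set of $g\in G$ such that $[\cdots[[g,x_1],x_2],\ldots,x_k]=1$ for all $x_i\in\Gamma_i(G)$, $i=1,\dots,k$. For groups $M,N$ acting compatibly on each other (and on themselves by conjugation), the non-abelian tensor product $M\otimes N$ (Brown–Loday) is the group generated by symbols $m\otimes x$ ($m\in M,x\in N$) with relations $mm'\otimes x=({}^{m}m'\otimes{}^{m}x)(m\otimes x)$ and $m\otimes xx'=(m\otimes x)({}^{x}m\otimes{}^{x}x')$.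 The exterior square $M\wedge M$ is the quotient of $M\otimes M$ (conjugation actions) by the normal closure of all $m\otimes m$. Tensor powers: $G^{\otimes1}=G$, $\lambda_1^G=\mathrm{id}$, and $G^{\otimes(n+1)}=G^{\otimes n}\otimes G$, where $G$ acts on $G^{\otimes n}$ diagonally (by conjugation on each factor) and $G^{\otimes n}$ acts on $G$ by conjugation through $\lambda_n^G\colon G^{\otimes n}\to G$; $\lambda_{n+1}^G(x\otimes g)=[\lambda_n^G(x),g]$. The image of $\lambda_n^G$ is $\gamma_n(G)$. Exterior powers: $G^{\wedge(1)}=G$, $\mu_1^G=\mathrm{id}$, $G^{\wedge(n+1)}=G^{\wedge(n)}\wedge G^{\wedge(n)}$, with $\mu_{n+1}^G\colon G^{\wedge(n+1)}\to G$, $\mu_{n+1}^G(a\wedge b)=[\mu_n^G(a),\mu_n^G(b)]$. The image of $\mu_n^G$ is $\Gamma_n(G)$. All these constructions are functorial in $G$. For $f\colon\Gamma\to G$: $G_f^{\otimes n}$ is the quotient of $G^{\otimes n}$ by the normal closure in $G^{\otimes n}$ of $f^{\otimes n}(\ker\lambda_n^\Gamma)$, and $G_f^{\wedge(n)}$ is the quotient of $G^{\wedge(n)}$ by the normal closure in $G^{\wedge(n)}$ of $f^{\wedge(n)}(\ker\mu_n^\Gamma)$. *)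

theory Defs
  imports "HOL-Algebra.Generated_Groups" "HOL-Algebra.Weak_Morphisms"
begin

section \<open>Commutators, series and normal closures\<close>

definition conj_by :: "('a, 'b) monoid_scheme \<Rightarrow> 'a \<Rightarrow> 'a \<Rightarrow> 'a" where
  "conj_by G x y = x \<otimes>\<^bsub>G\<^esub> y \<otimes>\<^bsub>G\<^esub> inv\<^bsub>G\<^esub> x"

definition commutator :: "('a, 'b) monoid_scheme \<Rightarrow> 'a \<Rightarrow> 'a \<Rightarrow> 'a" where
  "commutator G x y = x \<otimes>\<^bsub>G\<^esub> y \<otimes>\<^bsub>G\<^esub> inv\<^bsub>G\<^esub> x \<otimes>\<^bsub>G\<^esub> inv\<^bsub>G\<^esub> y"

definition normal_closure :: "('a, 'b) monoid_scheme \<Rightarrow> 'a set \<Rightarrow> 'a set" where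
  "normal_closure G S = generate G {conj_by G g s | g s. g \<in> carrier G \<and> s \<in> S}"

fun upper_central :: "('a, 'b) monoid_scheme \<Rightarrow> nat \<Rightarrow> 'a set" where
  "upper_central G 0 = {\<one>\<^bsub>G\<^esub>}"
| "upper_central G (Suc k) =
     {g \<in> carrier G. \<forall>x \<in> carrier G. commutator G g x \<in> upper_central G k}"

text \<open>The lower central series and the derived series are numbered from 1, as are the tensor and
  exterior powers below; the value at index 0 is never used.\<close>

fun lower_central :: "('a, 'b) monoid_scheme \<Rightarrow> nat \<Rightarrow> 'a set" where
  "lower_central G (Suc 0) = carrier G"
| "lower_central G (Suc (Suc k)) =
     generate G {commutator G x y | x y. x \<in> lower_central G (Suc k) \<and> y \<in> carrier G}"

definition derived_series :: "('a, 'b) monoid_scheme \<Rightarrow> nat \<Rightarrow> 'a set" where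
  "derived_series G k = (derived G ^^ (k - 1)) (carrier G)"

text \<open>\<open>iter_commutator G g x k\<close> is the left-normed commutator of \<open>g, x 1, \<dots>, x k\<close>.\<close>

fun iter_commutator :: "('a, 'b) monoid_scheme \<Rightarrow> 'a \<Rightarrow> (nat \<Rightarrow> 'a) \<Rightarrow> nat \<Rightarrow> 'a" where
  "iter_commutator G g x 0 = g"
| "iter_commutator G g x (Suc k) = commutator G (iter_commutator G g x k) (x (Suc k))"

definition frak_D :: "('a, 'b) monoid_scheme \<Rightarrow> nat \<Rightarrow> 'a set" where
  "frak_D G k = {g \<in> carrier G. \<forall>x. (\<forall>i \<in> {1..k}. x i \<in> derived_series G i)
     \<longrightarrow> iter_commutator G g x k = \<one>\<^bsub>G\<^esub>}"

definition f_extension ::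
    "'c monoid \<Rightarrow> 'a monoid \<Rightarrow> ('c \<Rightarrow> 'a) \<Rightarrow> 'b monoid \<Rightarrow> ('b \<Rightarrow> 'a) \<Rightarrow> bool" where
  "f_extension \<Gamma> G f Gt p \<longleftrightarrow>
     p \<in> epi Gt G \<and> (\<exists>ft \<in> hom \<Gamma> Gt. \<forall>x \<in> carrier \<Gamma>. p (ft x) = f x)"


section \<open>Groups given by generators and relations\<close>

text \<open>The letter \<open>(True, s)\<close> stands for the generator \<open>s\<close>, and \<open>(False, s)\<close> for its inverse. A
  relation \<open>u = v\<close> is given as the pair \<open>(u, v)\<close>.\<close>

type_synonym 's gword = "(bool \<times> 's) list"

abbreviation gwords :: "'s set \<Rightarrow> 's gword set" where
  "gwords S \<equiv> lists (UNIV \<times> S)"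

inductive pres_eq :: "'s set \<Rightarrow> ('s gword \<times> 's gword) set \<Rightarrow> 's gword \<Rightarrow> 's gword \<Rightarrow> bool"
  for S :: "'s set" and R :: "('s gword \<times> 's gword) set" where
  pres_refl: "u \<in> gwords S \<Longrightarrow> pres_eq S R u u"
| pres_sym: "pres_eq S R u v \<Longrightarrow> pres_eq S R v u"
| pres_trans: "pres_eq S R u v \<Longrightarrow> pres_eq S R v w \<Longrightarrow> pres_eq S R u w"
| pres_append: "pres_eq S R u u' \<Longrightarrow> pres_eq S R v v' \<Longrightarrow> pres_eq S R (u @ v) (u' @ v')"
| pres_cancel: "s \<in> S \<Longrightarrow> pres_eq S R [(b, s), (\<not> b, s)] []"
| pres_relation: "(u, v) \<in> R \<Longrightarrow> u \<in> gwords S \<Longrightarrow> v \<in> gwords S \<Longrightarrow> pres_eq S R u v"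

definition pres_class :: "'s set \<Rightarrow> ('s gword \<times> 's gword) set \<Rightarrow> 's gword \<Rightarrow> 's gword set" where
  "pres_class S R u = {v. pres_eq S R u v}"

definition presented_group ::
    "'s set \<Rightarrow> ('s gword \<times> 's gword) set \<Rightarrow> 's gword set monoid" where
  "presented_group S R =
     \<lparr>carrier = pres_class S R ` gwords S,
      mult = (\<lambda>A B. {w. \<exists>u \<in> A. \<exists>v \<in> B. pres_eq S R (u @ v) w}),
      one = pres_class S R []\<rparr>"

fun word_eval :: "('k, 'm) monoid_scheme \<Rightarrow> ('s \<Rightarrow> 'k) \<Rightarrow> 's gword \<Rightarrow> 'k" where
  "word_eval K \<phi> [] = \<one>\<^bsub>K\<^esub>"
| "word_eval K \<phi> ((b, s) # w) =
     (if b then \<phi> s else inv\<^bsub>K\<^esub> (\<phi> s)) \<otimes>\<^bsub>K\<^esub> word_eval K \<phi> w"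

text \<open>The map on a presented group induced by a map \<open>\<phi>\<close> on the generators. If \<open>\<phi>\<close> sends the
  relations to equalities in the group \<open>K\<close>, then all words in a class have the same value in \<open>K\<close>, and this
  is the unique homomorphism extending \<open>\<phi>\<close>.\<close>

definition pres_lift :: "('k, 'm) monoid_scheme \<Rightarrow> ('s \<Rightarrow> 'k) \<Rightarrow> 's gword set \<Rightarrow> 'k" where
  "pres_lift K \<phi> A = the_elem (word_eval K \<phi> ` A)"


section \<open>The non-abelian tensor product and the exterior square\<close>

text \<open>In \<open>tensor_prod M N a b\<close> the element \<open>a m x\<close> is the result of \<open>m \<in> M\<close> acting on
  \<open>x \<in> N\<close>, and \<open>b x m\<close> that of \<open>x \<in> N\<close> acting on \<open>m \<in> M\<close>. Each group acts on itself by
  conjugation.\<close>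

definition tensor_gens :: "'m monoid \<Rightarrow> 'n monoid \<Rightarrow> ('m \<times> 'n) set" where
  "tensor_gens M N = carrier M \<times> carrier N"

definition tensor_rels ::
    "'m monoid \<Rightarrow> 'n monoid \<Rightarrow> ('m \<Rightarrow> 'n \<Rightarrow> 'n) \<Rightarrow> ('n \<Rightarrow> 'm \<Rightarrow> 'm)
      \<Rightarrow> (('m \<times> 'n) gword \<times> ('m \<times> 'n) gword) set" where
  "tensor_rels M N a b =
     {([(True, (m \<otimes>\<^bsub>M\<^esub> m', x))], [(True, (conj_by M m m', a m x)), (True, (m, x))])
        | m m' x. m \<in> carrier M \<and> m' \<in> carrier M \<and> x \<in> carrier N}
   \<union> {([(True, (m, x \<otimes>\<^bsub>N\<^esub> x'))], [(True, (m, x)), (True, (b x m, conj_by N x x'))])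
        | m x x'. m \<in> carrier M \<and> x \<in> carrier N \<and> x' \<in> carrier N}"

definition tensor_prod ::
    "'m monoid \<Rightarrow> 'n monoid \<Rightarrow> ('m \<Rightarrow> 'n \<Rightarrow> 'n) \<Rightarrow> ('n \<Rightarrow> 'm \<Rightarrow> 'm)
      \<Rightarrow> ('m \<times> 'n) gword set monoid" where
  "tensor_prod M N a b = presented_group (tensor_gens M N) (tensor_rels M N a b)"

definition tensor_sym ::
    "'m monoid \<Rightarrow> 'n monoid \<Rightarrow> ('m \<Rightarrow> 'n \<Rightarrow> 'n) \<Rightarrow> ('n \<Rightarrow> 'm \<Rightarrow> 'm)
      \<Rightarrow> 'm \<Rightarrow> 'n \<Rightarrow> ('m \<times> 'n) gword set" where
  "tensor_sym M N a b m x =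
     pres_class (tensor_gens M N) (tensor_rels M N a b) [(True, (m, x))]"

definition tensor_lift ::
    "('k, 'l) monoid_scheme \<Rightarrow> ('m \<Rightarrow> 'n \<Rightarrow> 'k) \<Rightarrow> ('m \<times> 'n) gword set \<Rightarrow> 'k" where
  "tensor_lift K \<phi> = pres_lift K (\<lambda>(m, x). \<phi> m x)"

abbreviation tensor_square :: "'m monoid \<Rightarrow> ('m \<times> 'm) gword set monoid" where
  "tensor_square M \<equiv> tensor_prod M M (conj_by M) (conj_by M)"

abbreviation tensor_square_sym :: "'m monoid \<Rightarrow> 'm \<Rightarrow> 'm \<Rightarrow> ('m \<times> 'm) gword set" where
  "tensor_square_sym M \<equiv> tensor_sym M M (conj_by M) (conj_by M)"

definition diagonal_closure :: "'m monoid \<Rightarrow> ('m \<times> 'm) gword set set" where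
  "diagonal_closure M =
     normal_closure (tensor_square M) {tensor_square_sym M m m | m. m \<in> carrier M}"

definition exterior_square :: "'m monoid \<Rightarrow> ('m \<times> 'm) gword set set monoid" where
  "exterior_square M = tensor_square M Mod diagonal_closure M"

definition wedge_sym :: "'m monoid \<Rightarrow> 'm \<Rightarrow> 'm \<Rightarrow> ('m \<times> 'm) gword set set" where
  "wedge_sym M m m' = diagonal_closure M #>\<^bsub>tensor_square M\<^esub> tensor_square_sym M m m'"

definition wedge_lift ::
    "('k, 'l) monoid_scheme \<Rightarrow> ('m \<Rightarrow> 'm \<Rightarrow> 'k) \<Rightarrow> ('m \<times> 'm) gword set set \<Rightarrow> 'k" where
  "wedge_lift K \<phi> A = the_elem (tensor_lift K \<phi> ` A)"


section \<open>Tensor powers\<close>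

text \<open>All the powers of a group have to live in one type. So at every step the tensor product, whose
  elements are classes of words, is replaced by its isomorphic copy in which a class is labelled by
  one of its words; disjoint classes get different labels.\<close>

datatype 'a tpow = TBase 'a | TWord "(bool \<times> ('a tpow \<times> 'a)) list"

definition tlabel :: "('a tpow \<times> 'a) gword set \<Rightarrow> 'a tpow" where
  "tlabel A = TWord (SOME w. w \<in> A)"

text \<open>\<open>tens_pow G n\<close> is the \<open>n\<close>-th tensor power of \<open>G\<close>, \<open>tens_act G n\<close> the diagonal action of \<open>G\<close>
  on it and \<open>tens_lam G n\<close> the iterated commutator map to \<open>G\<close>. In \<open>tens_act\<close> and \<open>tens_lam\<close>,
  \<open>inv_into\<close> converts a label back to the class of words it denotes.\<close>

fun tens_pow :: "'a monoid \<Rightarrow> nat \<Rightarrow> 'a tpow monoid"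
  and tens_act :: "'a monoid \<Rightarrow> nat \<Rightarrow> 'a \<Rightarrow> 'a tpow \<Rightarrow> 'a tpow"
  and tens_lam :: "'a monoid \<Rightarrow> nat \<Rightarrow> 'a tpow \<Rightarrow> 'a" where
  "tens_pow G (Suc 0) = image_group TBase G"
| "tens_pow G (Suc (Suc n)) =
     image_group tlabel
       (tensor_prod (tens_pow G (Suc n)) G
         (\<lambda>x. conj_by G (tens_lam G (Suc n) x)) (tens_act G (Suc n)))"
| "tens_act G (Suc 0) = (\<lambda>g t. TBase (conj_by G g (inv_into (carrier G) TBase t)))"
| "tens_act G (Suc (Suc n)) =
     (let M = tens_pow G (Suc n);
          a = (\<lambda>x. conj_by G (tens_lam G (Suc n) x));
          b = tens_act G (Suc n);
          T = tensor_prod M G a b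
      in (\<lambda>g t. tlabel
           (tensor_lift T (\<lambda>x h. tensor_sym M G a b (b g x) (conj_by G g h))
             (inv_into (carrier T) tlabel t))))"
| "tens_lam G (Suc 0) = inv_into (carrier G) TBase"
| "tens_lam G (Suc (Suc n)) =
     (let T = tensor_prod (tens_pow G (Suc n)) G
                (\<lambda>x. conj_by G (tens_lam G (Suc n) x)) (tens_act G (Suc n))
      in (\<lambda>t. tensor_lift G (\<lambda>x g. commutator G (tens_lam G (Suc n) x) g)
           (inv_into (carrier T) tlabel t)))"

text \<open>The tensor product whose labelled copy is the tensor power of exponent \<open>n + 1\<close>, and its
  generators.\<close>

definition tens_step :: "'a monoid \<Rightarrow> nat \<Rightarrow> ('a tpow \<times> 'a) gword set monoid" where
  "tens_step G n =
     tensor_prod (tens_pow G n) G (\<lambda>x. conj_by G (tens_lam G n x)) (tens_act G n)"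

definition tens_step_sym :: "'a monoid \<Rightarrow> nat \<Rightarrow> 'a tpow \<Rightarrow> 'a \<Rightarrow> ('a tpow \<times> 'a) gword set" where
  "tens_step_sym G n =
     tensor_sym (tens_pow G n) G (\<lambda>x. conj_by G (tens_lam G n x)) (tens_act G n)"

lemma tens_pow_Suc_Suc:
  "tens_pow G (Suc (Suc n)) = image_group tlabel (tens_step G (Suc n))"
  by (simp add: tens_step_def)

lemma tens_act_Suc_Suc:
  "tens_act G (Suc (Suc n)) g t = tlabel
     (tensor_lift (tens_step G (Suc n))
       (\<lambda>x h. tens_step_sym G (Suc n) (tens_act G (Suc n) g x) (conj_by G g h))
       (inv_into (carrier (tens_step G (Suc n))) tlabel t))"
  by (simp add: tens_step_def tens_step_sym_def Let_def)

lemma tens_lam_Suc_Suc: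
  "tens_lam G (Suc (Suc n)) t =
     tensor_lift G (\<lambda>x g. commutator G (tens_lam G (Suc n) x) g)
       (inv_into (carrier (tens_step G (Suc n))) tlabel t)"
  by (simp add: tens_step_def Let_def)

text \<open>The homomorphism of \<open>n\<close>-th tensor powers induced by \<open>f\<close> from \<open>H\<close> to \<open>G\<close>.\<close>

fun tens_map :: "'c monoid \<Rightarrow> 'a monoid \<Rightarrow> ('c \<Rightarrow> 'a) \<Rightarrow> nat \<Rightarrow> 'c tpow \<Rightarrow> 'a tpow" where
  "tens_map H G f (Suc 0) = (\<lambda>t. TBase (f (inv_into (carrier H) TBase t)))"
| "tens_map H G f (Suc (Suc n)) = (\<lambda>t. tlabel
     (tensor_lift (tens_step G (Suc n))
       (\<lambda>x h. tens_step_sym G (Suc n) (tens_map H G f (Suc n) x) (f h))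
       (inv_into (carrier (tens_step H (Suc n))) tlabel t)))"

definition tens_pow_f :: "'c monoid \<Rightarrow> 'a monoid \<Rightarrow> ('c \<Rightarrow> 'a) \<Rightarrow> nat \<Rightarrow> 'a tpow set monoid" where
  "tens_pow_f \<Gamma> G f n =
     tens_pow G n Mod normal_closure (tens_pow G n)
       (tens_map \<Gamma> G f n ` kernel (tens_pow \<Gamma> n) \<Gamma> (tens_lam \<Gamma> n))"


section \<open>Exterior powers\<close>

datatype 'a epow = EBase 'a | EWord "(bool \<times> ('a epow \<times> 'a epow)) list"

text \<open>An element of an exterior square is a coset, that is, a set of classes of words. It is
  labelled by a word lying in one of these classes.\<close>

definition elabel :: "('a epow \<times> 'a epow) gword set set \<Rightarrow> 'a epow" where
  "elabel A = EWord (SOME w. w \<in> \<Union>A)"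

fun ext_pow :: "'a monoid \<Rightarrow> nat \<Rightarrow> 'a epow monoid" where
  "ext_pow G (Suc 0) = image_group EBase G"
| "ext_pow G (Suc (Suc n)) = image_group elabel (exterior_square (ext_pow G (Suc n)))"

fun ext_mu :: "'a monoid \<Rightarrow> nat \<Rightarrow> 'a epow \<Rightarrow> 'a" where
  "ext_mu G (Suc 0) = inv_into (carrier G) EBase"
| "ext_mu G (Suc (Suc n)) = (\<lambda>t.
     wedge_lift G (\<lambda>a b. commutator G (ext_mu G (Suc n) a) (ext_mu G (Suc n) b))
       (inv_into (carrier (exterior_square (ext_pow G (Suc n)))) elabel t))"

fun ext_map :: "'c monoid \<Rightarrow> 'a monoid \<Rightarrow> ('c \<Rightarrow> 'a) \<Rightarrow> nat \<Rightarrow> 'c epow \<Rightarrow> 'a epow" where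
  "ext_map H G f (Suc 0) = (\<lambda>t. EBase (f (inv_into (carrier H) EBase t)))"
| "ext_map H G f (Suc (Suc n)) = (\<lambda>t. elabel
     (wedge_lift (exterior_square (ext_pow G (Suc n)))
       (\<lambda>a b. wedge_sym (ext_pow G (Suc n))
                (ext_map H G f (Suc n) a) (ext_map H G f (Suc n) b))
       (inv_into (carrier (exterior_square (ext_pow H (Suc n)))) elabel t)))"

definition ext_pow_f :: "'c monoid \<Rightarrow> 'a monoid \<Rightarrow> ('c \<Rightarrow> 'a) \<Rightarrow> nat \<Rightarrow> 'a epow set monoid" where
  "ext_pow_f \<Gamma> G f n =
     ext_pow G n Mod normal_closure (ext_pow G n)
       (ext_map \<Gamma> G f n ` kernel (ext_pow \<Gamma> n) \<Gamma> (ext_mu \<Gamma> n))"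

end

theory Submission
  imports Defs
begin

text \<open>
  A left-normed commutator of elements of \<open>G\<close> can be lifted to \<open>Gt\<close> by lifting its entries along \<open>p\<close>.
  The result depends on the choice of the lifts, and the theorem holds because the hypothesis on the
  kernel of \<open>p\<close> makes this dependence disappear once \<open>n\<close> entries have been used. The epimorphism then
  takes \<open>x\<^sub>1 \<otimes> \<dots> \<otimes> x\<^sub>n\<close> to \<open>[\<dots>[y\<^sub>1, y\<^sub>2], \<dots>, y\<^sub>n]\<close>, where \<open>y\<^sub>i\<close> is any element over \<open>x\<^sub>i\<close>.

  To see that this is a homomorphism, the ambiguity is measured at every stage. For \<open>1 \<le> k \<le> n\<close> there is a
  homomorphism \<open>l\<^sub>k\<close> from the \<open>k\<close>-th tensor power of \<open>G\<close> to the quotient of \<open>Gt\<close> by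
  \<open>N\<^sub>k = Z\<^sub>n\<^sub>-\<^sub>k \<inter> \<gamma>\<^sub>k \<inter> ker p\<close>. For \<open>k = 1\<close> it is the isomorphism from \<open>G\<close> to the quotient by the kernel of \<open>p\<close>,
  and \<open>l\<^sub>k\<^sub>+\<^sub>1\<close> takes \<open>m \<otimes> x\<close> to the coset of \<open>[u, y]\<close>, with \<open>u\<close> in the coset \<open>l\<^sub>k m\<close> and \<open>y\<close> over \<open>x\<close>. Changing
  \<open>u\<close> by an element of \<open>N\<^sub>k\<close> alters the commutator only by an element of \<open>N\<^sub>k\<^sub>+\<^sub>1\<close>, as \<open>[Z\<^sub>n\<^sub>-\<^sub>k, Gt] \<subseteq> Z\<^sub>n\<^sub>-\<^sub>k\<^sub>-\<^sub>1\<close>.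
  Changing \<open>y\<close> by an element of the kernel of \<open>p\<close> does the same, as
  \<open>[\<gamma>\<^sub>k, Z\<^sub>n\<^sub>-\<^sub>1] \<subseteq> Z\<^sub>n\<^sub>-\<^sub>1\<^sub>-\<^sub>k\<close> (\<open>lower_upper_commutator\<close>). The relations of the tensor product are
  respected since they are the identities that expand the commutator of a product. All cosets
  together make up \<open>\<gamma>\<^sub>k\<close>. Since \<open>N\<^sub>n\<close> is trivial, \<open>l\<^sub>n\<close> is a homomorphism onto \<open>\<gamma>\<^sub>n\<close>.

  Write \<open>ft\<close> for the lift of \<open>f\<close> to \<open>Gt\<close>. On the image of the tensor power of \<open>\<Gamma>\<close> the entries can be
  lifted through \<open>ft\<close>, so there \<open>l\<^sub>n\<close> is the composite of the commutator map of \<open>\<Gamma>\<close> with \<open>ft\<close>. Hence \<open>l\<^sub>n\<close>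
  is trivial on the image of the kernel of that commutator map, and it factors through the quotient
  in question.

  The exterior powers are treated in the same way, with \<open>N\<^sub>k = E\<^sub>k \<inter> \<Gamma>\<^sub>k \<inter> ker p\<close>, where \<open>E\<^sub>n\<close> is trivial and
  \<open>E\<^sub>k\<close> consists of the elements whose commutators with \<open>\<Gamma>\<^sub>k\<close> lie in \<open>E\<^sub>k\<^sub>+\<^sub>1\<close>; then \<open>E\<^sub>1\<close> is \<open>\<DD>\<^sub>n\<^sub>-\<^sub>1\<close>. Here
  both entries of a commutator come from the previous stage and lie in \<open>\<Gamma>\<^sub>k\<close>, so the definition of \<open>E\<^sub>k\<close>
  bounds both changes at once.

  The general mechanism is the commutator pairing of two homomorphisms into different quotients of
  one group (\<open>coset_pairing\<close>); \<open>tens_coset_lift_Suc\<close> and \<open>ext_coset_lift_Suc\<close> apply it to the powers.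
  Besides, the tensor and exterior powers have to be shown to be functorial, by means of their universal
  properties.
\<close>

section \<open>Commutators, cosets and normal closures\<close>

lemma (in group) inv_cancel_left:
  assumes "x \<in> carrier G" "y \<in> carrier G"
  shows "inv x \<otimes> (x \<otimes> y) = y" "x \<otimes> (inv x \<otimes> y) = y"
  using assms by (simp_all flip: m_assoc)

text \<open>Together with the group axioms these rules bring a product of letters and inverses of letters
  to its reduced form, so the simplifier decides every identity between commutators and conjugates
  below.\<close>

lemmas (in group) word_simps =
  commutator_def conj_by_def inv_mult_group m_assoc inv_cancel_left

lemma (in group) commutator_closed [simp]:
  "\<lbrakk>x \<in> carrier G; y \<in> carrier G\<rbrakk> \<Longrightarrow> commutator G x y \<in> carrier G"
  by (simp add: commutator_def)

lemma (in group) conj_by_closed [simp]: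
  "\<lbrakk>x \<in> carrier G; y \<in> carrier G\<rbrakk> \<Longrightarrow> conj_by G x y \<in> carrier G"
  by (simp add: conj_by_def)

lemma (in group) conj_by_mult:
  assumes "g \<in> carrier G" "x \<in> carrier G" "y \<in> carrier G"
  shows "conj_by G g (x \<otimes> y) = conj_by G g x \<otimes> conj_by G g y"
  using assms by (simp add: word_simps)

lemma (in group) conj_by_mult_left:
  assumes "g \<in> carrier G" "h \<in> carrier G" "x \<in> carrier G"
  shows "conj_by G (g \<otimes> h) x = conj_by G g (conj_by G h x)"
  using assms by (simp add: word_simps)

lemma (in group) conj_by_conj_by:
  assumes "g \<in> carrier G" "h \<in> carrier G" "x \<in> carrier G"
  shows "conj_by G g (conj_by G h x) = conj_by G (conj_by G g h) (conj_by G g x)"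
  using assms by (simp add: word_simps)

lemma (in group) conj_by_hom: "g \<in> carrier G \<Longrightarrow> conj_by G g \<in> hom G G"
  by (auto simp: hom_def conj_by_mult)

lemma (in group) conj_by_commutator:
  assumes "g \<in> carrier G" "x \<in> carrier G" "y \<in> carrier G"
  shows "conj_by G g (commutator G x y) = commutator G (conj_by G g x) (conj_by G g y)"
  using assms by (simp add: word_simps)

text \<open>This identity and the next one are the two defining relations of the non-abelian tensor
  product, with the commutator in the role of the symbol. They are the reason why commutators
  define homomorphisms on tensor products at all.\<close>

lemma (in group) commutator_mult_left:
  assumes "x \<in> carrier G" "y \<in> carrier G" "z \<in> carrier G"
  shows "commutator G (x \<otimes> y) z =
    commutator G (conj_by G x y) (conj_by G x z) \<otimes> commutator G x z"
  using assms by (simp add: word_simps)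

lemma (in group) commutator_mult_right:
  assumes "x \<in> carrier G" "y \<in> carrier G" "z \<in> carrier G"
  shows "commutator G x (y \<otimes> z) =
    commutator G x y \<otimes> commutator G (conj_by G y x) (conj_by G y z)"
  using assms by (simp add: word_simps)

lemma (in group) inv_commutator:
  assumes "x \<in> carrier G" "y \<in> carrier G"
  shows "inv (commutator G x y) = commutator G y x"
  using assms by (simp add: word_simps)

lemma (in group) commutator_self: "x \<in> carrier G \<Longrightarrow> commutator G x x = \<one>"
  by (simp add: word_simps)

lemma hom_conj_by:
  assumes "h \<in> hom G H" "group G" "group H" "x \<in> carrier G" "y \<in> carrier G"
  shows "h (conj_by G x y) = conj_by H (h x) (h y)"
proof -
  interpret group_hom G H h using assms by (simp add: group_hom_def group_hom_axioms_def)
  show ?thesis using assms by (simp add: conj_by_def)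
qed

lemma hom_commutator:
  assumes "h \<in> hom G H" "group G" "group H" "x \<in> carrier G" "y \<in> carrier G"
  shows "h (commutator G x y) = commutator H (h x) (h y)"
proof -
  interpret group_hom G H h using assms by (simp add: group_hom_def group_hom_axioms_def)
  show ?thesis using assms by (simp add: commutator_def)
qed

lemma (in normal) conj_by_mem: "\<lbrakk>g \<in> carrier G; x \<in> H\<rbrakk> \<Longrightarrow> conj_by G g x \<in> H"
  by (simp add: conj_by_def inv_op_closed2)

lemma (in normal) rcoset_mult_left: "\<lbrakk>x \<in> H; g \<in> carrier G\<rbrakk> \<Longrightarrow> H #> (x \<otimes> g) = H #> g"
  by (metis coset_join2 coset_mult_assoc is_subgroup mem_carrier subset)

lemma (in normal) rcoset_mult_right: "\<lbrakk>x \<in> H; g \<in> carrier G\<rbrakk> \<Longrightarrow> H #> (g \<otimes> x) = H #> g"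
proof -
  assume a: "x \<in> H" "g \<in> carrier G"
  then have "g \<otimes> x = conj_by G g x \<otimes> g" by (simp add: word_simps)
  with a show ?thesis by (simp add: rcoset_mult_left conj_by_mem)
qed

lemma (in normal) rcoset_eqD:
  "\<lbrakk>x \<in> carrier G; y \<in> carrier G; H #> x = H #> y\<rbrakk> \<Longrightarrow> \<exists>e\<in>H. x = y \<otimes> e"
  by (metis coset_eq rcos_self is_subgroup l_coset_def UN_E singletonD)

lemma (in group) normalI_conj:
  "\<lbrakk>subgroup N G; \<And>g x. \<lbrakk>g \<in> carrier G; x \<in> N\<rbrakk> \<Longrightarrow> conj_by G g x \<in> N\<rbrakk> \<Longrightarrow> N \<lhd> G"
  by (simp add: normal_inv_iff conj_by_def)

lemma (in group) generate_normal:
  assumes "S \<subseteq> carrier G" "\<And>g s. \<lbrakk>g \<in> carrier G; s \<in> S\<rbrakk> \<Longrightarrow> conj_by G g s \<in> S"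
  shows "generate G S \<lhd> G"
  using normal_generateI[of S] assms by (simp add: conj_by_def)

lemma (in group) normal_closure_normal:
  assumes "S \<subseteq> carrier G" shows "normal_closure G S \<lhd> G"
  unfolding normal_closure_def
proof (rule generate_normal)
  show "{conj_by G g s |g s. g \<in> carrier G \<and> s \<in> S} \<subseteq> carrier G" using assms by auto
  fix h t assume h: "h \<in> carrier G" "t \<in> {conj_by G g s |g s. g \<in> carrier G \<and> s \<in> S}"
  then obtain g s where g: "g \<in> carrier G" "s \<in> S" "t = conj_by G g s" by blast
  then have "conj_by G h t = conj_by G (h \<otimes> g) s" "h \<otimes> g \<in> carrier G"
    using h assms by (auto simp: conj_by_mult_left subsetD)
  with g show "conj_by G h t \<in> {conj_by G g s |g s. g \<in> carrier G \<and> s \<in> S}" by blast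
qed

lemma (in group) mem_normal_closure:
  assumes "S \<subseteq> carrier G" "s \<in> S" shows "s \<in> normal_closure G S"
proof -
  have "s = conj_by G \<one> s" using assms by (auto simp: conj_by_def)
  then show ?thesis using assms unfolding normal_closure_def by (blast intro: generate.incl)
qed

lemma (in group_hom) normal_closure_in_kernel:
  assumes "S \<subseteq> kernel G H h" shows "normal_closure G S \<subseteq> kernel G H h"
  unfolding normal_closure_def
proof (rule G.generate_subgroup_incl[OF _ subgroup_kernel])
  have "conj_by G g s \<in> kernel G H h" if "g \<in> carrier G" "s \<in> S" for g s
    using normal.conj_by_mem[OF normal_kernel] that assms by blast
  then show "{conj_by G g s |g s. g \<in> carrier G \<and> s \<in> S} \<subseteq> kernel G H h" by blast
qed

lemma (in group_hom) the_elem_image_rcoset: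
  assumes "N \<lhd> G" "N \<subseteq> kernel G H h" "x \<in> carrier G"
  shows "the_elem (h ` (N #> x)) = h x"
proof -
  interpret N: normal N G by fact
  have "h ` (N #> x) = {h x}"
  proof
    show "h ` (N #> x) \<subseteq> {h x}" using assms by (auto simp: r_coset_def kernel_def)
    show "{h x} \<subseteq> h ` (N #> x)"
      using G.rcos_self[OF assms(3) N.subgroup_axioms] by blast
  qed
  then show ?thesis by simp
qed

text \<open>The map induced on a quotient, in the form in which the exterior square is mapped to other
  groups: a coset goes to the single element of its image.\<close>

lemma (in group_hom) quotient_hom:
  assumes "N \<lhd> G" "N \<subseteq> kernel G H h"
  shows "(\<lambda>A. the_elem (h ` A)) \<in> hom (G Mod N) H"
proof (rule homI)
  interpret N: normal N G by fact
  fix A assume "A \<in> carrier (G Mod N)"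
  then obtain x where x: "x \<in> carrier G" "A = N #> x" by (auto simp: carrier_FactGroup)
  then show "the_elem (h ` A) \<in> carrier H" using assms by (simp add: the_elem_image_rcoset)
  fix B assume "B \<in> carrier (G Mod N)"
  then obtain y where y: "y \<in> carrier G" "B = N #> y" by (auto simp: carrier_FactGroup)
  show "the_elem (h ` (A \<otimes>\<^bsub>G Mod N\<^esub> B)) = the_elem (h ` A) \<otimes>\<^bsub>H\<^esub> the_elem (h ` B)"
    using x y assms by (simp add: the_elem_image_rcoset N.rcos_sum)
qed

lemma hom_eq_on_generate:
  assumes "group G" "group H" "h \<in> hom G H" "k \<in> hom G H" "S \<subseteq> carrier G"
    and eq: "\<And>s. s \<in> S \<Longrightarrow> h s = k s" and x: "x \<in> generate G S"
  shows "h x = k x"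
proof -
  interpret h: group_hom G H h using assms by (simp add: group_hom_def group_hom_axioms_def)
  interpret k: group_hom G H k using assms by (simp add: group_hom_def group_hom_axioms_def)
  show ?thesis
    using x
  proof induction
    case (eng a b)
    then show ?case using group.generate_in_carrier[OF assms(1,5)] by simp
  qed (use eq assms(5) in auto)
qed

section \<open>Groups given by generators and relations\<close>

text \<open>The membership of a word in the set of all words over given letters is used as a whole; the
  classical rules that split it into statements on the single letters get in the way.\<close>

declare in_listsD [rule del] in_listsI [rule del]

lemma pres_eq_gwords: "pres_eq S R u v \<Longrightarrow> u \<in> gwords S \<and> v \<in> gwords S"
  by (induction rule: pres_eq.induct) auto

lemma pres_class_eq_iff:
  assumes "u \<in> gwords S"
  shows "pres_class S R u = pres_class S R v \<longleftrightarrow> pres_eq S R u v"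
proof
  assume "pres_class S R u = pres_class S R v"
  then have "pres_eq S R v u" using pres_refl[OF assms] unfolding pres_class_def by blast
  then show "pres_eq S R u v" by (rule pres_sym)
next
  assume uv: "pres_eq S R u v"
  show "pres_class S R u = pres_class S R v"
    unfolding pres_class_def using pres_trans[OF uv] pres_trans[OF pres_sym[OF uv]] by blast
qed

lemma mem_pres_class: "u \<in> gwords S \<Longrightarrow> u \<in> pres_class S R u"
  by (simp add: pres_class_def pres_refl)

lemma carrier_presented_group: "carrier (presented_group S R) = pres_class S R ` gwords S"
  by (simp add: presented_group_def)

lemma one_presented_group: "\<one>\<^bsub>presented_group S R\<^esub> = pres_class S R []"
  by (simp add: presented_group_def)

lemma mult_presented_group:
  assumes "u \<in> gwords S" "v \<in> gwords S"
  shows "pres_class S R u \<otimes>\<^bsub>presented_group S R\<^esub> pres_class S R v = pres_class S R (u @ v)"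
proof -
  have "(\<exists>u'. pres_eq S R u u' \<and> (\<exists>v'. pres_eq S R v v' \<and> pres_eq S R (u' @ v') w))
      \<longleftrightarrow> pres_eq S R (u @ v) w" for w
  proof
    assume "\<exists>u'. pres_eq S R u u' \<and> (\<exists>v'. pres_eq S R v v' \<and> pres_eq S R (u' @ v') w)"
    then show "pres_eq S R (u @ v) w" by (blast intro: pres_append pres_trans)
  next
    assume "pres_eq S R (u @ v) w"
    then show "\<exists>u'. pres_eq S R u u' \<and> (\<exists>v'. pres_eq S R v v' \<and> pres_eq S R (u' @ v') w)"
      using pres_refl[OF assms(1)] pres_refl[OF assms(2)] by blast
  qed
  then show ?thesis by (auto simp: presented_group_def pres_class_def)
qed

abbreviation word_inverse :: "'s gword \<Rightarrow> 's gword" where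
  "word_inverse w \<equiv> rev (map (\<lambda>(b, s). (\<not> b, s)) w)"

lemma word_inverse_gwords: "w \<in> gwords S \<Longrightarrow> word_inverse w \<in> gwords S"
  by (auto simp: in_lists_conv_set)

lemma pres_eq_word_inverse: "w \<in> gwords S \<Longrightarrow> pres_eq S R (word_inverse w @ w) []"
proof (induction w)
  case Nil
  then show ?case by (simp add: pres_refl)
next
  case (Cons l w)
  obtain b s where l: "l = (b, s)" by fastforce
  have w: "w \<in> gwords S" "word_inverse w \<in> gwords S" and s: "s \<in> S"
    using Cons.prems l word_inverse_gwords by auto
  have "pres_eq S R [(\<not> b, s), l] []" using pres_cancel[OF s, of R "\<not> b"] l by simp
  then have "pres_eq S R (word_inverse w @ ([(\<not> b, s), l] @ w)) (word_inverse w @ ([] @ w))"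
    using w by (intro pres_append pres_refl)
  then show ?case using pres_trans[OF _ Cons.IH[OF w(1)]] l by simp
qed

lemma presented_group_group: "group (presented_group S R)"
proof (rule groupI)
  fix x y z
  assume "x \<in> carrier (presented_group S R)" "y \<in> carrier (presented_group S R)"
    "z \<in> carrier (presented_group S R)"
  then show "x \<otimes>\<^bsub>presented_group S R\<^esub> y \<otimes>\<^bsub>presented_group S R\<^esub> z =
      x \<otimes>\<^bsub>presented_group S R\<^esub> (y \<otimes>\<^bsub>presented_group S R\<^esub> z)"
    by (auto simp: carrier_presented_group mult_presented_group)
next
  fix x assume "x \<in> carrier (presented_group S R)"
  then obtain w where w: "w \<in> gwords S" "x = pres_class S R w"
    by (auto simp: carrier_presented_group)
  have "pres_class S R (word_inverse w) \<otimes>\<^bsub>presented_group S R\<^esub> x = \<one>\<^bsub>presented_group S R\<^esub>"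
    using w pres_eq_word_inverse[OF w(1)] word_inverse_gwords[OF w(1)]
    by (simp add: mult_presented_group one_presented_group pres_class_eq_iff)
  moreover have "pres_class S R (word_inverse w) \<in> carrier (presented_group S R)"
    using word_inverse_gwords[OF w(1)] by (simp add: carrier_presented_group)
  ultimately show "\<exists>y\<in>carrier (presented_group S R). y \<otimes>\<^bsub>presented_group S R\<^esub> x = \<one>\<^bsub>presented_group S R\<^esub>"
    by blast
qed (auto simp: carrier_presented_group mult_presented_group one_presented_group)

lemma presented_group_generated:
  "carrier (presented_group S R) =
    generate (presented_group S R) ((\<lambda>s. pres_class S R [(True, s)]) ` S)"
    (is "carrier ?P = generate ?P ?X")
proof
  interpret group ?P by (rule presented_group_group)
  have X: "?X \<subseteq> carrier ?P" by (auto simp: carrier_presented_group)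
  show "generate ?P ?X \<subseteq> carrier ?P" using generate_incl[OF X] .
  have "pres_class S R w \<in> generate ?P ?X" if "w \<in> gwords S" for w
    using that
  proof (induction w rule: list.induct)
    case Nil
    then show ?case using generate.one[of ?P] by (simp add: one_presented_group)
  next
    case (Cons l w)
    obtain b s where l: "l = (b, s)" by fastforce
    have s: "s \<in> S" and w: "w \<in> gwords S" using Cons.prems l by auto
    have gen: "pres_class S R [(True, s)] \<in> ?X" using s by blast
    have "pres_class S R [(False, s)] = inv\<^bsub>?P\<^esub> (pres_class S R [(True, s)])"
      using pres_cancel[OF s, of R False] s
      by (intro inv_equality[symmetric])
        (auto simp: mult_presented_group one_presented_group pres_class_eq_iff
          carrier_presented_group)
    then have "pres_class S R [l] \<in> generate ?P ?X"
      using generate.incl[OF gen, of ?P] generate.inv[OF gen, of ?P] l by (cases b) simp_all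
    moreover have "pres_class S R (l # w) = pres_class S R [l] \<otimes>\<^bsub>?P\<^esub> pres_class S R w"
      using s w l by (simp add: mult_presented_group)
    ultimately show ?case using generate.eng[OF _ Cons.IH[OF w]] by simp
  qed
  then show "carrier ?P \<subseteq> generate ?P ?X" by (auto simp: carrier_presented_group)
qed

lemma (in group) word_eval_closed:
  "\<lbrakk>\<phi> \<in> S \<rightarrow> carrier G; w \<in> gwords S\<rbrakk> \<Longrightarrow> word_eval G \<phi> w \<in> carrier G"
  by (induction w) (auto simp: Pi_iff)

lemma (in group) word_eval_append:
  "\<lbrakk>\<phi> \<in> S \<rightarrow> carrier G; u \<in> gwords S; v \<in> gwords S\<rbrakk> \<Longrightarrow>
    word_eval G \<phi> (u @ v) = word_eval G \<phi> u \<otimes> word_eval G \<phi> v"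
proof (induction u)
  case (Cons l u)
  then show ?case
    using word_eval_closed[OF Cons.prems(1)] by (cases l) (auto simp: m_assoc Pi_iff)
qed (simp add: word_eval_closed)

text \<open>The condition of von Dyck's theorem: the assignment extends to the presented group.\<close>

definition respects_relations ::
    "'s set \<Rightarrow> ('s gword \<times> 's gword) set \<Rightarrow> ('k, 'm) monoid_scheme \<Rightarrow> ('s \<Rightarrow> 'k) \<Rightarrow> bool" where
  "respects_relations S R K \<phi> \<longleftrightarrow> \<phi> \<in> S \<rightarrow> carrier K \<and>
     (\<forall>(u, v) \<in> R. u \<in> gwords S \<longrightarrow> v \<in> gwords S \<longrightarrow> word_eval K \<phi> u = word_eval K \<phi> v)"

lemma (in group) word_eval_pres_eq:
  assumes \<phi>: "respects_relations S R G \<phi>" and "pres_eq S R u v"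
  shows "word_eval G \<phi> u = word_eval G \<phi> v"
  using assms(2)
proof induction
  have maps: "\<phi> \<in> S \<rightarrow> carrier G" using \<phi> by (simp add: respects_relations_def)
  {
    case (pres_append u u' v v')
    then show ?case
      using pres_eq_gwords[OF pres_append.hyps(1)] pres_eq_gwords[OF pres_append.hyps(2)]
      by (simp add: word_eval_append[OF maps])
  next
    case (pres_cancel s b)
    then have "\<phi> s \<in> carrier G" using maps by auto
    then show ?case by (cases b) auto
  next
    case (pres_relation u v)
    then show ?case using \<phi> by (auto simp: respects_relations_def)
  }
qed auto

lemma (in group) pres_lift_class:
  assumes "respects_relations S R G \<phi>" "w \<in> gwords S"
  shows "pres_lift G \<phi> (pres_class S R w) = word_eval G \<phi> w"
proof -
  have "word_eval G \<phi> ` pres_class S R w = {word_eval G \<phi> w}"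
    using word_eval_pres_eq[OF assms(1)] mem_pres_class[OF assms(2)]
    by (fastforce simp: pres_class_def)
  then show ?thesis by (simp add: pres_lift_def)
qed

lemma (in group) pres_lift_hom:
  assumes \<phi>: "respects_relations S R G \<phi>"
  shows "pres_lift G \<phi> \<in> hom (presented_group S R) G"
proof -
  have maps: "\<phi> \<in> S \<rightarrow> carrier G" using \<phi> by (simp add: respects_relations_def)
  show ?thesis
    using word_eval_closed[OF maps] word_eval_append[OF maps]
    by (auto intro!: homI
        simp: carrier_presented_group mult_presented_group pres_lift_class[OF \<phi>])
qed

lemma (in group) pres_lift_generator:
  assumes "respects_relations S R G \<phi>" "s \<in> S"
  shows "pres_lift G \<phi> (pres_class S R [(True, s)]) = \<phi> s"
proof -
  have "\<phi> s \<in> carrier G" using assms by (auto simp: respects_relations_def)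
  then show ?thesis using assms by (simp add: pres_lift_class)
qed

section \<open>Universal properties of the tensor product and the exterior square\<close>

text \<open>These maps are the crossed pairings of Brown and Loday: the defining relations of the tensor
  product, read in the group \<open>K\<close>. They correspond to the homomorphisms from the tensor
  product to \<open>K\<close>.\<close>

definition tensor_pairing ::
    "'m monoid \<Rightarrow> 'n monoid \<Rightarrow> ('m \<Rightarrow> 'n \<Rightarrow> 'n) \<Rightarrow> ('n \<Rightarrow> 'm \<Rightarrow> 'm)
      \<Rightarrow> ('k, 'l) monoid_scheme \<Rightarrow> ('m \<Rightarrow> 'n \<Rightarrow> 'k) \<Rightarrow> bool" where
  "tensor_pairing M N a b K \<phi> \<longleftrightarrow>
     (\<forall>m\<in>carrier M. \<forall>x\<in>carrier N. \<phi> m x \<in> carrier K) \<and>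
     (\<forall>m\<in>carrier M. \<forall>m'\<in>carrier M. \<forall>x\<in>carrier N.
        \<phi> (m \<otimes>\<^bsub>M\<^esub> m') x = \<phi> (conj_by M m m') (a m x) \<otimes>\<^bsub>K\<^esub> \<phi> m x) \<and>
     (\<forall>m\<in>carrier M. \<forall>x\<in>carrier N. \<forall>x'\<in>carrier N.
        \<phi> m (x \<otimes>\<^bsub>N\<^esub> x') = \<phi> m x \<otimes>\<^bsub>K\<^esub> \<phi> (b x m) (conj_by N x x'))"

lemma tensor_pairing_closed:
  "\<lbrakk>tensor_pairing M N a b K \<phi>; m \<in> carrier M; x \<in> carrier N\<rbrakk> \<Longrightarrow> \<phi> m x \<in> carrier K"
  by (simp add: tensor_pairing_def)

lemma tensor_pairing_respects_relations:
  assumes K: "group K" and \<phi>: "tensor_pairing M N a b K \<phi>"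
  shows "respects_relations (tensor_gens M N) (tensor_rels M N a b) K (\<lambda>(m, x). \<phi> m x)"
proof -
  interpret group K by fact
  show ?thesis
    using \<phi> unfolding respects_relations_def tensor_rels_def tensor_gens_def tensor_pairing_def
    by auto
qed

lemma tensor_lift_hom:
  assumes "group K" "tensor_pairing M N a b K \<phi>"
  shows "tensor_lift K \<phi> \<in> hom (tensor_prod M N a b) K"
  unfolding tensor_lift_def tensor_prod_def
  using group.pres_lift_hom[OF assms(1) tensor_pairing_respects_relations[OF assms]] .

lemma tensor_lift_sym:
  assumes "group K" "tensor_pairing M N a b K \<phi>" "m \<in> carrier M" "x \<in> carrier N"
  shows "tensor_lift K \<phi> (tensor_sym M N a b m x) = \<phi> m x"
  using group.pres_lift_generator[OF assms(1) tensor_pairing_respects_relations[OF assms(1,2)],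
      of "(m, x)"] assms(3,4)
  by (simp add: tensor_lift_def tensor_sym_def tensor_gens_def)

lemma tensor_prod_group: "group (tensor_prod M N a b)"
  by (simp add: tensor_prod_def presented_group_group)

lemma tensor_prod_generated:
  "carrier (tensor_prod M N a b) = generate (tensor_prod M N a b)
     {tensor_sym M N a b m x |m x. m \<in> carrier M \<and> x \<in> carrier N}"
proof -
  have "{tensor_sym M N a b m x |m x. m \<in> carrier M \<and> x \<in> carrier N} =
      (\<lambda>s. pres_class (tensor_gens M N) (tensor_rels M N a b) [(True, s)]) ` tensor_gens M N"
    by (auto simp: tensor_sym_def tensor_gens_def)
  then show ?thesis
    using presented_group_generated[of "tensor_gens M N" "tensor_rels M N a b"]
    by (simp add: tensor_prod_def)
qed

lemma tensor_sym_pairing: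
  assumes "group M" "group N"
    and a: "\<And>m x. \<lbrakk>m \<in> carrier M; x \<in> carrier N\<rbrakk> \<Longrightarrow> a m x \<in> carrier N"
    and b: "\<And>m x. \<lbrakk>m \<in> carrier M; x \<in> carrier N\<rbrakk> \<Longrightarrow> b x m \<in> carrier M"
  shows "tensor_pairing M N a b (tensor_prod M N a b) (tensor_sym M N a b)"
proof -
  interpret M: group M by fact
  interpret N: group N by fact
  let ?S = "tensor_gens M N" and ?R = "tensor_rels M N a b"
  have eq: "pres_class ?S ?R u = pres_class ?S ?R v"
    if "(u, v) \<in> ?R" "u \<in> gwords ?S" "v \<in> gwords ?S" for u v
    using that by (simp add: pres_class_eq_iff pres_relation)
  show ?thesis
    unfolding tensor_pairing_def
  proof (intro conjI ballI)
    fix m x assume "m \<in> carrier M" "x \<in> carrier N"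
    then show "tensor_sym M N a b m x \<in> carrier (tensor_prod M N a b)"
      by (simp add: tensor_sym_def tensor_prod_def tensor_gens_def carrier_presented_group)
  next
    fix m m' x assume h: "m \<in> carrier M" "m' \<in> carrier M" "x \<in> carrier N"
    then have "([(True, (m \<otimes>\<^bsub>M\<^esub> m', x))], [(True, (conj_by M m m', a m x)), (True, (m, x))]) \<in> ?R"
      unfolding tensor_rels_def by blast
    from eq[OF this] show "tensor_sym M N a b (m \<otimes>\<^bsub>M\<^esub> m') x =
        tensor_sym M N a b (conj_by M m m') (a m x) \<otimes>\<^bsub>tensor_prod M N a b\<^esub> tensor_sym M N a b m x"
      using h a b by (simp add: tensor_sym_def tensor_prod_def mult_presented_group tensor_gens_def)
  next
    fix m x x' assume h: "m \<in> carrier M" "x \<in> carrier N" "x' \<in> carrier N"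
    then have "([(True, (m, x \<otimes>\<^bsub>N\<^esub> x'))], [(True, (m, x)), (True, (b x m, conj_by N x x'))]) \<in> ?R"
      unfolding tensor_rels_def by blast
    from eq[OF this] show "tensor_sym M N a b m (x \<otimes>\<^bsub>N\<^esub> x') =
        tensor_sym M N a b m x \<otimes>\<^bsub>tensor_prod M N a b\<^esub> tensor_sym M N a b (b x m) (conj_by N x x')"
      using h a b by (simp add: tensor_sym_def tensor_prod_def mult_presented_group tensor_gens_def)
  qed
qed

lemma tensor_pairing_hom:
  assumes "tensor_pairing M N a b K \<phi>" "h \<in> hom K L"
    and "group M" "group N"
    and "\<And>m x. \<lbrakk>m \<in> carrier M; x \<in> carrier N\<rbrakk> \<Longrightarrow> a m x \<in> carrier N"
    and "\<And>m x. \<lbrakk>m \<in> carrier M; x \<in> carrier N\<rbrakk> \<Longrightarrow> b x m \<in> carrier M"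
  shows "tensor_pairing M N a b L (\<lambda>m x. h (\<phi> m x))"
proof -
  interpret M: group M by fact
  interpret N: group N by fact
  show ?thesis
    using assms unfolding tensor_pairing_def by (simp add: hom_mult hom_in_carrier)
qed

text \<open>The functoriality of the tensor product: with the universal pairing for \<open>\<phi>\<close>, a pair of
  homomorphisms that respects both actions induces a homomorphism between the tensor products.
  The diagonal action and the map induced by a homomorphism of groups arise in this way.\<close>

lemma tensor_pairing_pullback:
  assumes "tensor_pairing M' N' a' b' K \<phi>"
    and M: "group M" "group M'" "u \<in> hom M M'" and N: "group N" "group N'" "v \<in> hom N N'"
    and a: "\<And>m x. \<lbrakk>m \<in> carrier M; x \<in> carrier N\<rbrakk> \<Longrightarrow> v (a m x) = a' (u m) (v x)"
    and b: "\<And>m x. \<lbrakk>m \<in> carrier M; x \<in> carrier N\<rbrakk> \<Longrightarrow> u (b x m) = b' (v x) (u m)"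
  shows "tensor_pairing M N a b K (\<lambda>m x. \<phi> (u m) (v x))"
proof -
  have "u (conj_by M m m') = conj_by M' (u m) (u m')" if "m \<in> carrier M" "m' \<in> carrier M" for m m'
    using hom_conj_by[OF M(3,1,2)] that .
  moreover have "v (conj_by N x x') = conj_by N' (v x) (v x')"
    if "x \<in> carrier N" "x' \<in> carrier N" for x x'
    using hom_conj_by[OF N(3,1,2)] that .
  ultimately show ?thesis
    using assms unfolding tensor_pairing_def by (simp add: hom_mult hom_in_carrier)
qed

text \<open>The source of the iterated commutator maps. The hypotheses on the actions translate the
  relations of the tensor product into the two commutator identities.\<close>

lemma commutator_pairing:
  assumes K: "group K" and M: "group M" "u \<in> hom M K" and N: "group N" "v \<in> hom N K"
    and a: "\<And>m x. \<lbrakk>m \<in> carrier M; x \<in> carrier N\<rbrakk> \<Longrightarrow> v (a m x) = conj_by K (u m) (v x)"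
    and b: "\<And>m x. \<lbrakk>m \<in> carrier M; x \<in> carrier N\<rbrakk> \<Longrightarrow> u (b x m) = conj_by K (v x) (u m)"
  shows "tensor_pairing M N a b K (\<lambda>m x. commutator K (u m) (v x))"
proof -
  interpret K: group K by fact
  have "u (conj_by M m m') = conj_by K (u m) (u m')" if "m \<in> carrier M" "m' \<in> carrier M" for m m'
    using hom_conj_by[OF M(2,1) K] that .
  moreover have "v (conj_by N x x') = conj_by K (v x) (v x')"
    if "x \<in> carrier N" "x' \<in> carrier N" for x x'
    using hom_conj_by[OF N(2,1) K] that .
  ultimately show ?thesis
    using assms unfolding tensor_pairing_def
    by (simp add: hom_mult hom_in_carrier K.commutator_mult_left K.commutator_mult_right)
qed

definition wedge_pairing ::
    "'m monoid \<Rightarrow> ('k, 'l) monoid_scheme \<Rightarrow> ('m \<Rightarrow> 'm \<Rightarrow> 'k) \<Rightarrow> bool" where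
  "wedge_pairing M K \<phi> \<longleftrightarrow> tensor_pairing M M (conj_by M) (conj_by M) K \<phi> \<and>
     (\<forall>m\<in>carrier M. \<phi> m m = \<one>\<^bsub>K\<^esub>)"

lemma wedge_pairing_tensor:
  "wedge_pairing M K \<phi> \<Longrightarrow> tensor_pairing M M (conj_by M) (conj_by M) K \<phi>"
  by (simp add: wedge_pairing_def)

lemma tensor_square_sym_pairing:
  "group M \<Longrightarrow>
    tensor_pairing M M (conj_by M) (conj_by M) (tensor_square M) (tensor_square_sym M)"
  by (rule tensor_sym_pairing) (auto intro: group.conj_by_closed)

lemma diagonal_closure_normal:
  assumes "group M" shows "diagonal_closure M \<lhd> tensor_square M"
proof -
  interpret T: group "tensor_square M" by (rule tensor_prod_group)
  show ?thesis
    unfolding diagonal_closure_def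
    by (rule T.normal_closure_normal)
      (auto intro: tensor_pairing_closed[OF tensor_square_sym_pairing[OF assms]])
qed

lemma exterior_square_group: "group M \<Longrightarrow> group (exterior_square M)"
  unfolding exterior_square_def using diagonal_closure_normal normal.factorgroup_is_group by blast

lemma diagonal_closure_coset_hom:
  "group M \<Longrightarrow> (\<lambda>t. diagonal_closure M #>\<^bsub>tensor_square M\<^esub> t) \<in> hom (tensor_square M) (exterior_square M)"
  unfolding exterior_square_def using diagonal_closure_normal normal.r_coset_hom_Mod by blast

lemma wedge_sym_pairing:
  assumes "group M" shows "wedge_pairing M (exterior_square M) (wedge_sym M)"
  unfolding wedge_pairing_def
proof (intro conjI ballI)
  show "tensor_pairing M M (conj_by M) (conj_by M) (exterior_square M) (wedge_sym M)"
    unfolding wedge_sym_def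
    by (rule tensor_pairing_hom[OF tensor_square_sym_pairing[OF assms]
          diagonal_closure_coset_hom[OF assms] assms assms])
      (auto intro: group.conj_by_closed[OF assms])
next
  interpret T: group "tensor_square M" by (rule tensor_prod_group)
  interpret D: normal "diagonal_closure M" "tensor_square M" by (rule diagonal_closure_normal[OF assms])
  fix m assume m: "m \<in> carrier M"
  have sub: "{tensor_square_sym M m m |m. m \<in> carrier M} \<subseteq> carrier (tensor_square M)"
    by (auto intro: tensor_pairing_closed[OF tensor_square_sym_pairing[OF assms]])
  have "tensor_square_sym M m m \<in> diagonal_closure M"
    unfolding diagonal_closure_def using m by (intro T.mem_normal_closure[OF sub]) blast
  then have "wedge_sym M m m = diagonal_closure M"
    unfolding wedge_sym_def by (simp add: D.rcos_const)
  then show "wedge_sym M m m = \<one>\<^bsub>exterior_square M\<^esub>"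
    by (simp add: exterior_square_def)
qed

lemma exterior_square_generated:
  assumes "group M"
  shows "carrier (exterior_square M) =
    generate (exterior_square M) {wedge_sym M m m' |m m'. m \<in> carrier M \<and> m' \<in> carrier M}"
proof -
  let ?T = "tensor_square M" and ?E = "exterior_square M"
  let ?q = "\<lambda>t. diagonal_closure M #>\<^bsub>?T\<^esub> t"
  let ?X = "{tensor_square_sym M m m' |m m'. m \<in> carrier M \<and> m' \<in> carrier M}"
  interpret q: group_hom ?T ?E ?q
    using tensor_prod_group exterior_square_group[OF assms] diagonal_closure_coset_hom[OF assms]
    by (simp add: group_hom_def group_hom_axioms_def)
  have X: "?X \<subseteq> carrier ?T"
    by (auto intro: tensor_pairing_closed[OF tensor_square_sym_pairing[OF assms]])
  have "carrier ?E = ?q ` generate ?T ?X"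
    using tensor_prod_generated[of M M "conj_by M" "conj_by M"]
    by (simp add: exterior_square_def carrier_FactGroup)
  also have "\<dots> = generate ?E (?q ` ?X)" using q.generate_img[OF X] by simp
  also have "?q ` ?X = {wedge_sym M m m' |m m'. m \<in> carrier M \<and> m' \<in> carrier M}"
    unfolding wedge_sym_def by blast
  finally show ?thesis .
qed

text \<open>A crossed pairing that kills the diagonal gives a homomorphism on the tensor square whose
  kernel contains the normal closure of all \<open>m \<otimes> m\<close>, so it descends to the exterior square.\<close>

lemma
  assumes M: "group M" and K: "group K" and \<phi>: "wedge_pairing M K \<phi>"
  shows wedge_lift_hom: "wedge_lift K \<phi> \<in> hom (exterior_square M) K"
    and wedge_lift_sym:
      "\<lbrakk>m \<in> carrier M; m' \<in> carrier M\<rbrakk> \<Longrightarrow> wedge_lift K \<phi> (wedge_sym M m m') = \<phi> m m'"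
proof -
  note \<phi>' = wedge_pairing_tensor[OF \<phi>]
  interpret l: group_hom "tensor_square M" K "tensor_lift K \<phi>"
    using tensor_prod_group K tensor_lift_hom[OF K \<phi>']
    by (simp add: group_hom_def group_hom_axioms_def)
  note sym = tensor_pairing_closed[OF tensor_square_sym_pairing[OF M]]
  have D: "diagonal_closure M \<subseteq> kernel (tensor_square M) K (tensor_lift K \<phi>)"
    unfolding diagonal_closure_def
    using \<phi> by (intro l.normal_closure_in_kernel)
      (auto simp: kernel_def sym wedge_pairing_def tensor_lift_sym[OF K \<phi>'])
  show "wedge_lift K \<phi> \<in> hom (exterior_square M) K"
    using l.quotient_hom[OF diagonal_closure_normal[OF M] D]
    unfolding wedge_lift_def[abs_def] exterior_square_def .
  show "wedge_lift K \<phi> (wedge_sym M m m') = \<phi> m m'" if "m \<in> carrier M" "m' \<in> carrier M"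
    unfolding wedge_lift_def wedge_sym_def
    using l.the_elem_image_rcoset[OF diagonal_closure_normal[OF M] D sym[OF that]]
      tensor_lift_sym[OF K \<phi>' that] by simp
qed

lemma pres_class_eqI:
  assumes "A \<in> carrier (presented_group S R)" "B \<in> carrier (presented_group S R)" "w \<in> A" "w \<in> B"
  shows "A = B"
proof -
  obtain u v where u: "u \<in> gwords S" "A = pres_class S R u" and v: "v \<in> gwords S" "B = pres_class S R v"
    using assms(1,2) by (auto simp: carrier_presented_group)
  then have "pres_eq S R u v"
    using assms(3,4) unfolding pres_class_def by (blast intro: pres_sym pres_trans)
  then show ?thesis using u v pres_class_eq_iff by blast
qed

lemma presented_group_nonempty: "A \<in> carrier (presented_group S R) \<Longrightarrow> A \<noteq> {}"
  using mem_pres_class by (fastforce simp: carrier_presented_group)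

text \<open>Two classes of words with a common element are equal, so any word of a class determines it.
  Hence the labelled copies are isomorphic to the groups that they replace, and the universal
  properties carry over to them.\<close>

lemma inj_tlabel: "inj_on tlabel (carrier (tensor_prod M N a b))"
proof (rule inj_onI)
  fix A B assume AB: "A \<in> carrier (tensor_prod M N a b)" "B \<in> carrier (tensor_prod M N a b)"
    and "tlabel A = tlabel B"
  then have "(SOME w. w \<in> A) = (SOME w. w \<in> B)" by (simp add: tlabel_def)
  moreover have "A \<noteq> {}" "B \<noteq> {}" using AB[unfolded tensor_prod_def, THEN presented_group_nonempty] by simp_all
  ultimately show "A = B"
    using pres_class_eqI[OF AB[unfolded tensor_prod_def]] by (metis some_in_eq)
qed

text \<open>Here a word determines the class that contains it, and this class determines its coset.\<close>

lemma inj_elabel: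
  assumes "group M" shows "inj_on elabel (carrier (exterior_square M))"
proof (rule inj_onI)
  let ?T = "tensor_square M" and ?D = "diagonal_closure M"
  interpret D: normal ?D ?T by (rule diagonal_closure_normal[OF assms])
  fix A B assume AB: "A \<in> carrier (exterior_square M)" "B \<in> carrier (exterior_square M)"
    and "elabel A = elabel B"
  then have eq: "(SOME w. w \<in> \<Union>A) = (SOME w. w \<in> \<Union>B)" by (simp add: elabel_def)
  have rc: "A \<in> rcosets\<^bsub>?T\<^esub> ?D" "B \<in> rcosets\<^bsub>?T\<^esub> ?D"
    using AB by (simp_all add: exterior_square_def FactGroup_def)
  have sub: "A \<subseteq> carrier ?T" "B \<subseteq> carrier ?T"
    using rc D.rcosets_carrier by auto
  have ne: "c \<noteq> {}" if "c \<in> carrier ?T" for c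
    using that[unfolded tensor_prod_def, THEN presented_group_nonempty] .
  have "\<Union>A \<noteq> {}" "\<Union>B \<noteq> {}"
    using rc[THEN D.rcosets_non_empty] sub ne by blast+
  then obtain w where "w \<in> \<Union>A" "w \<in> \<Union>B" using eq by (metis some_in_eq)
  then obtain c d where cd: "c \<in> A" "w \<in> c" "d \<in> B" "w \<in> d" by blast
  then have "c = d"
    using sub pres_class_eqI[of c _ _ d w] unfolding tensor_prod_def by blast
  then show "A = B"
    using cd D.rcos_disjoint[OF D.subgroup_axioms] rc by (auto simp: pairwise_def disjnt_def)
qed

lemma image_group_lift:
  assumes "inj_on l (carrier G)" "h \<in> hom G K" "group G"
  shows "(\<lambda>t. h (inv_into (carrier G) l t)) \<in> hom (image_group l G) K"
proof -
  interpret group G by fact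
  show ?thesis
    using assms by (auto simp: hom_def image_group_def)
qed

lemma image_group_label:
  "inj_on l (carrier G) \<Longrightarrow> l \<in> hom G (image_group l G)"
  using inj_imp_image_group_iso by (auto simp: iso_def)

lemma image_group_generated:
  assumes "inj_on l (carrier G)" "group G" "S \<subseteq> carrier G" "carrier G = generate G S"
  shows "carrier (image_group l G) = generate (image_group l G) (l ` S)"
proof -
  interpret group_hom G "image_group l G" l
    using group.inj_imp_image_group_is_group[OF assms(2,1)] image_group_label[OF assms(1)] assms(2)
    by (simp add: group_hom_def group_hom_axioms_def)
  show ?thesis using generate_img[OF assms(3)] assms(4) by (simp add: image_group_carrier)
qed

section \<open>Tensor powers\<close>

text \<open>A precrossed module over \<open>G\<close>. The action law and the equivariance of \<open>l\<close> are the conditions under which the diagonal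
  action on \<open>M \<otimes> G\<close> and the map \<open>m \<otimes> g \<mapsto> [l m, g]\<close> respect the relations, and both then form
  a precrossed module again. So the notion is exactly what the recursion for tensor powers carries
  along.\<close>

definition precrossed ::
    "'a monoid \<Rightarrow> 'm monoid \<Rightarrow> ('m \<Rightarrow> 'a) \<Rightarrow> ('a \<Rightarrow> 'm \<Rightarrow> 'm) \<Rightarrow> bool" where
  "precrossed G M l b \<longleftrightarrow> group M \<and> l \<in> hom M G \<and> (\<forall>g\<in>carrier G. b g \<in> hom M M) \<and>
     (\<forall>g\<in>carrier G. \<forall>h\<in>carrier G. \<forall>m\<in>carrier M. b (g \<otimes>\<^bsub>G\<^esub> h) m = b g (b h m)) \<and>
     (\<forall>g\<in>carrier G. \<forall>m\<in>carrier M. l (b g m) = conj_by G g (l m))"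

abbreviation tens_pow_precrossed :: "'a monoid \<Rightarrow> nat \<Rightarrow> bool" where
  "tens_pow_precrossed G n \<equiv> precrossed G (tens_pow G n) (tens_lam G n) (tens_act G n)"

abbreviation tens_pow_pairing ::
    "'a monoid \<Rightarrow> nat \<Rightarrow> ('k, 'l) monoid_scheme \<Rightarrow> ('a tpow \<Rightarrow> 'a \<Rightarrow> 'k) \<Rightarrow> bool" where
  "tens_pow_pairing G n K \<phi> \<equiv>
     tensor_pairing (tens_pow G n) G (\<lambda>x. conj_by G (tens_lam G n x)) (tens_act G n) K \<phi>"

text \<open>The elements \<open>x \<otimes> g\<close> of the labelled tensor power of exponent \<open>n + 1\<close>, and the homomorphism that a
  crossed pairing induces on it. They let the tensor power be handled through its generators and its
  universal property alone, without the words and classes behind the labels.\<close>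

definition tens_pow_sym :: "'a monoid \<Rightarrow> nat \<Rightarrow> 'a tpow \<Rightarrow> 'a \<Rightarrow> 'a tpow" where
  "tens_pow_sym G n x g = tlabel (tens_step_sym G n x g)"

definition tens_pow_lift ::
    "'a monoid \<Rightarrow> nat \<Rightarrow> ('k, 'l) monoid_scheme \<Rightarrow> ('a tpow \<Rightarrow> 'a \<Rightarrow> 'k) \<Rightarrow> 'a tpow \<Rightarrow> 'k" where
  "tens_pow_lift G n K \<phi> t = tensor_lift K \<phi> (inv_into (carrier (tens_step G n)) tlabel t)"

lemma tens_step_group: "group (tens_step G n)"
  by (simp add: tens_step_def tensor_prod_group)

lemma inj_tlabel_step: "inj_on tlabel (carrier (tens_step G n))"
  by (simp add: tens_step_def inj_tlabel)

lemma tens_pow_Suc_group: "group (tens_pow G (Suc (Suc k)))"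
  unfolding tens_pow_Suc_Suc
  by (rule group.inj_imp_image_group_is_group[OF tens_step_group inj_tlabel_step])

lemma tlabel_hom: "tlabel \<in> hom (tens_step G (Suc k)) (tens_pow G (Suc (Suc k)))"
  unfolding tens_pow_Suc_Suc by (rule image_group_label[OF inj_tlabel_step])

context
  fixes G :: "'a monoid" and k :: nat
  assumes G: "group G" and pc: "tens_pow_precrossed G (Suc k)"
begin

interpretation G: group G by (rule G)

lemma lam_hom: "tens_lam G (Suc k) \<in> hom (tens_pow G (Suc k)) G"
  using pc by (simp add: precrossed_def)

lemma tens_step_actions_closed:
  "\<lbrakk>m \<in> carrier (tens_pow G (Suc k)); x \<in> carrier G\<rbrakk>
    \<Longrightarrow> conj_by G (tens_lam G (Suc k) m) x \<in> carrier G"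
  "\<lbrakk>m \<in> carrier (tens_pow G (Suc k)); x \<in> carrier G\<rbrakk>
    \<Longrightarrow> tens_act G (Suc k) x m \<in> carrier (tens_pow G (Suc k))"
  using pc hom_in_carrier by (fastforce simp: precrossed_def)+

lemma tens_step_sym_pairing:
  "tens_pow_pairing G (Suc k) (tens_step G (Suc k)) (tens_step_sym G (Suc k))"
proof -
  have M: "group (tens_pow G (Suc k))" using pc by (simp add: precrossed_def)
  show ?thesis
    unfolding tens_step_def tens_step_sym_def
    by (rule tensor_sym_pairing[OF M G]) (use tens_step_actions_closed in auto)
qed

lemma tens_pow_sym_pairing:
  "tens_pow_pairing G (Suc k) (tens_pow G (Suc (Suc k))) (tens_pow_sym G (Suc k))"
proof -
  have M: "group (tens_pow G (Suc k))" using pc by (simp add: precrossed_def)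
  show ?thesis
    unfolding tens_pow_sym_def
    by (rule tensor_pairing_hom[OF tens_step_sym_pairing tlabel_hom M G])
      (use tens_step_actions_closed in auto)
qed

lemma tens_pow_generated:
  "carrier (tens_pow G (Suc (Suc k))) = generate (tens_pow G (Suc (Suc k)))
     {tens_pow_sym G (Suc k) x g |x g. x \<in> carrier (tens_pow G (Suc k)) \<and> g \<in> carrier G}"
proof -
  let ?X = "{tens_step_sym G (Suc k) x g |x g. x \<in> carrier (tens_pow G (Suc k)) \<and> g \<in> carrier G}"
  have X: "?X \<subseteq> carrier (tens_step G (Suc k))"
    by (auto intro: tensor_pairing_closed[OF tens_step_sym_pairing])
  have gen: "carrier (tens_step G (Suc k)) = generate (tens_step G (Suc k)) ?X"
    unfolding tens_step_def tens_step_sym_def by (rule tensor_prod_generated)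
  have "tlabel ` ?X =
      {tens_pow_sym G (Suc k) x g |x g. x \<in> carrier (tens_pow G (Suc k)) \<and> g \<in> carrier G}"
    unfolding tens_pow_sym_def by blast
  then show ?thesis
    using image_group_generated[OF inj_tlabel_step tens_step_group X gen]
    unfolding tens_pow_Suc_Suc by simp
qed

lemma tens_pow_sym_closed:
  "\<lbrakk>x \<in> carrier (tens_pow G (Suc k)); g \<in> carrier G\<rbrakk>
    \<Longrightarrow> tens_pow_sym G (Suc k) x g \<in> carrier (tens_pow G (Suc (Suc k)))"
  by (rule tensor_pairing_closed[OF tens_pow_sym_pairing])

text \<open>Identities between homomorphisms on a tensor power are checked on the symbols. All laws for
  actions, commutator maps and induced maps are obtained in this way.\<close>

lemma tens_pow_hom_eq:
  assumes "group K" "h \<in> hom (tens_pow G (Suc (Suc k))) K" "h' \<in> hom (tens_pow G (Suc (Suc k))) K"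
    and "\<And>x g. \<lbrakk>x \<in> carrier (tens_pow G (Suc k)); g \<in> carrier G\<rbrakk>
      \<Longrightarrow> h (tens_pow_sym G (Suc k) x g) = h' (tens_pow_sym G (Suc k) x g)"
    and t: "t \<in> carrier (tens_pow G (Suc (Suc k)))"
  shows "h t = h' t"
proof (rule hom_eq_on_generate[OF tens_pow_Suc_group assms(1,2,3)])
  show "t \<in> generate (tens_pow G (Suc (Suc k)))
     {tens_pow_sym G (Suc k) x g |x g. x \<in> carrier (tens_pow G (Suc k)) \<and> g \<in> carrier G}"
    using t tens_pow_generated by simp
qed (use assms(4) tens_pow_sym_closed in auto)

lemma tens_pow_lift_hom:
  assumes "group K" "tens_pow_pairing G (Suc k) K \<phi>"
  shows "tens_pow_lift G (Suc k) K \<phi> \<in> hom (tens_pow G (Suc (Suc k))) K"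
proof -
  have "tensor_lift K \<phi> \<in> hom (tens_step G (Suc k)) K"
    unfolding tens_step_def by (rule tensor_lift_hom[OF assms])
  then show ?thesis
    unfolding tens_pow_Suc_Suc tens_pow_lift_def[abs_def]
    by (rule image_group_lift[OF inj_tlabel_step _ tens_step_group])
qed

lemma tens_pow_lift_sym:
  assumes "group K" "tens_pow_pairing G (Suc k) K \<phi>"
    and "x \<in> carrier (tens_pow G (Suc k))" "g \<in> carrier G"
  shows "tens_pow_lift G (Suc k) K \<phi> (tens_pow_sym G (Suc k) x g) = \<phi> x g"
proof -
  have "tens_step_sym G (Suc k) x g \<in> carrier (tens_step G (Suc k))"
    using assms(3,4) by (rule tensor_pairing_closed[OF tens_step_sym_pairing])
  then have "tens_pow_lift G (Suc k) K \<phi> (tens_pow_sym G (Suc k) x g) =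
      tensor_lift K \<phi> (tens_step_sym G (Suc k) x g)"
    unfolding tens_pow_lift_def tens_pow_sym_def
    by (simp add: inv_into_f_f[OF inj_tlabel_step])
  then show ?thesis
    using tensor_lift_sym[OF assms] unfolding tens_step_sym_def by simp
qed

lemma tens_lam_pairing:
  "tens_pow_pairing G (Suc k) G (\<lambda>x g. commutator G (tens_lam G (Suc k) x) g)"
proof -
  have "group (tens_pow G (Suc k))" using pc by (simp add: precrossed_def)
  then show ?thesis
    using commutator_pairing[OF G _ lam_hom G, of "\<lambda>g. g" "\<lambda>x. conj_by G (tens_lam G (Suc k) x)"
        "tens_act G (Suc k)"] pc
    by (simp add: precrossed_def hom_def)
qed

lemma tens_lam_lift:
  "tens_lam G (Suc (Suc k)) =
    tens_pow_lift G (Suc k) G (\<lambda>x g. commutator G (tens_lam G (Suc k) x) g)"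
  by (rule ext) (simp only: tens_lam_Suc_Suc tens_pow_lift_def)

lemma tens_lam_Suc_hom: "tens_lam G (Suc (Suc k)) \<in> hom (tens_pow G (Suc (Suc k))) G"
  unfolding tens_lam_lift by (rule tens_pow_lift_hom[OF G tens_lam_pairing])

lemma tens_lam_sym:
  "\<lbrakk>x \<in> carrier (tens_pow G (Suc k)); g \<in> carrier G\<rbrakk> \<Longrightarrow>
    tens_lam G (Suc (Suc k)) (tens_pow_sym G (Suc k) x g) = commutator G (tens_lam G (Suc k) x) g"
  unfolding tens_lam_lift by (rule tens_pow_lift_sym[OF G tens_lam_pairing])

text \<open>The action of \<open>g\<close> comes from the pair of its action on the lower power and the conjugation by \<open>g\<close>
  on \<open>G\<close>. This pair respects the two actions: one condition is the equivariance of the commutator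
  map, the other one is the action law applied to \<open>(g x g\<inverse>) g = g x\<close>.\<close>

lemma tens_act_pairing:
  assumes g: "g \<in> carrier G"
  shows "tens_pow_pairing G (Suc k) (tens_step G (Suc k))
    (\<lambda>x h. tens_step_sym G (Suc k) (tens_act G (Suc k) g x) (conj_by G g h))"
proof (rule tensor_pairing_pullback[OF tens_step_sym_pairing _ _ _ G G])
  fix m x assume m: "m \<in> carrier (tens_pow G (Suc k))" and x: "x \<in> carrier G"
  have lm: "tens_lam G (Suc k) m \<in> carrier G" using lam_hom m by (rule hom_in_carrier)
  show "conj_by G g (conj_by G (tens_lam G (Suc k) m) x) =
      conj_by G (tens_lam G (Suc k) (tens_act G (Suc k) g m)) (conj_by G g x)"
    using g m x lm pc by (simp add: precrossed_def G.conj_by_conj_by[of g])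
  have "conj_by G g x \<otimes>\<^bsub>G\<^esub> g = g \<otimes>\<^bsub>G\<^esub> x"
    using g x by (simp add: G.word_simps)
  then show "tens_act G (Suc k) g (tens_act G (Suc k) x m) =
      tens_act G (Suc k) (conj_by G g x) (tens_act G (Suc k) g m)"
    using g m x pc unfolding precrossed_def by (metis G.conj_by_closed)
qed (use g pc G.conj_by_hom in \<open>auto simp: precrossed_def\<close>)

lemma tens_act_lift:
  "tens_act G (Suc (Suc k)) g = (\<lambda>t. tlabel (tens_pow_lift G (Suc k) (tens_step G (Suc k))
    (\<lambda>x h. tens_step_sym G (Suc k) (tens_act G (Suc k) g x) (conj_by G g h)) t))"
  by (rule ext) (simp only: tens_act_Suc_Suc tens_pow_lift_def)

lemma tens_act_Suc_hom:
  "g \<in> carrier G \<Longrightarrow>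
    tens_act G (Suc (Suc k)) g \<in> hom (tens_pow G (Suc (Suc k))) (tens_pow G (Suc (Suc k)))"
  unfolding tens_act_lift
  using hom_compose[OF tens_pow_lift_hom[OF tens_step_group tens_act_pairing] tlabel_hom]
  by (simp add: comp_def)

lemma tens_act_sym:
  "\<lbrakk>g \<in> carrier G; x \<in> carrier (tens_pow G (Suc k)); h \<in> carrier G\<rbrakk> \<Longrightarrow>
    tens_act G (Suc (Suc k)) g (tens_pow_sym G (Suc k) x h) =
      tens_pow_sym G (Suc k) (tens_act G (Suc k) g x) (conj_by G g h)"
  unfolding tens_act_lift
  by (simp add: tens_pow_lift_sym[OF tens_step_group tens_act_pairing] tens_pow_sym_def[of _ _ "tens_act G (Suc k) g x"])

lemma tens_pow_precrossed_step: "tens_pow_precrossed G (Suc (Suc k))"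
  unfolding precrossed_def
proof (intro conjI ballI)
  note act_closed = tens_step_actions_closed(2)
  show "group (tens_pow G (Suc (Suc k)))" by (rule tens_pow_Suc_group)
  show "tens_lam G (Suc (Suc k)) \<in> hom (tens_pow G (Suc (Suc k))) G" by (rule tens_lam_Suc_hom)
  fix g assume g: "g \<in> carrier G"
  then show "tens_act G (Suc (Suc k)) g \<in> hom (tens_pow G (Suc (Suc k))) (tens_pow G (Suc (Suc k)))"
    by (rule tens_act_Suc_hom)
  {
    fix h t assume h: "h \<in> carrier G" and t: "t \<in> carrier (tens_pow G (Suc (Suc k)))"
    have "tens_act G (Suc (Suc k)) (g \<otimes>\<^bsub>G\<^esub> h) t =
        (tens_act G (Suc (Suc k)) g \<circ> tens_act G (Suc (Suc k)) h) t"
    proof (rule tens_pow_hom_eq[OF tens_pow_Suc_group _ _ _ t])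
      show "tens_act G (Suc (Suc k)) g \<circ> tens_act G (Suc (Suc k)) h
          \<in> hom (tens_pow G (Suc (Suc k))) (tens_pow G (Suc (Suc k)))"
        using hom_compose tens_act_Suc_hom g h by blast
    next
      fix x y assume "x \<in> carrier (tens_pow G (Suc k))" "y \<in> carrier G"
      then show "tens_act G (Suc (Suc k)) (g \<otimes>\<^bsub>G\<^esub> h) (tens_pow_sym G (Suc k) x y) =
          (tens_act G (Suc (Suc k)) g \<circ> tens_act G (Suc (Suc k)) h) (tens_pow_sym G (Suc k) x y)"
        using g h pc act_closed
        by (simp del: tens_act.simps add: tens_act_sym precrossed_def G.conj_by_mult_left)
    qed (use g h tens_act_Suc_hom in auto)
    then show "tens_act G (Suc (Suc k)) (g \<otimes>\<^bsub>G\<^esub> h) t =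
        tens_act G (Suc (Suc k)) g (tens_act G (Suc (Suc k)) h t)" by (simp del: tens_act.simps)
  }
  fix t assume t: "t \<in> carrier (tens_pow G (Suc (Suc k)))"
  have "(tens_lam G (Suc (Suc k)) \<circ> tens_act G (Suc (Suc k)) g) t =
      (conj_by G g \<circ> tens_lam G (Suc (Suc k))) t"
  proof (rule tens_pow_hom_eq[OF G _ _ _ t])
    show "tens_lam G (Suc (Suc k)) \<circ> tens_act G (Suc (Suc k)) g \<in> hom (tens_pow G (Suc (Suc k))) G"
      using hom_compose[OF tens_act_Suc_hom[OF g] tens_lam_Suc_hom] .
    show "conj_by G g \<circ> tens_lam G (Suc (Suc k)) \<in> hom (tens_pow G (Suc (Suc k))) G"
      using hom_compose[OF tens_lam_Suc_hom G.conj_by_hom[OF g]] .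
  next
    fix x y assume x: "x \<in> carrier (tens_pow G (Suc k))" and y: "y \<in> carrier G"
    show "(tens_lam G (Suc (Suc k)) \<circ> tens_act G (Suc (Suc k)) g) (tens_pow_sym G (Suc k) x y) =
        (conj_by G g \<circ> tens_lam G (Suc (Suc k))) (tens_pow_sym G (Suc k) x y)"
      using x y g pc act_closed hom_in_carrier[OF lam_hom x]
      by (simp del: tens_act.simps tens_lam.simps
          add: tens_act_sym tens_lam_sym precrossed_def G.conj_by_commutator)
  qed
  then show "tens_lam G (Suc (Suc k)) (tens_act G (Suc (Suc k)) g t) =
      conj_by G g (tens_lam G (Suc (Suc k)) t)" by (simp del: tens_act.simps tens_lam.simps)
qed

end

lemma inj_TBase: "inj_on TBase A" and inj_EBase: "inj_on EBase A"
  by (simp_all add: inj_on_def)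

lemma tens_pow_precrossed:
  assumes "group G" shows "tens_pow_precrossed G (Suc k)"
proof (induction k)
  case 0
  interpret G: group G by fact
  have "group (image_group TBase G)" by (rule G.inj_imp_image_group_is_group[OF inj_TBase])
  moreover have "inv_into (carrier G) TBase \<in> hom (image_group TBase G) G"
    using image_group_lift[OF inj_TBase, of "\<lambda>g. g" G G] assms by (simp add: hom_def)
  moreover have "(\<lambda>t. TBase (conj_by G g (inv_into (carrier G) TBase t)))
      \<in> hom (image_group TBase G) (image_group TBase G)" if "g \<in> carrier G" for g
    using image_group_lift[OF inj_TBase hom_compose[OF G.conj_by_hom[OF that]
        image_group_label[OF inj_TBase]] assms] by simp
  ultimately show ?case
    by (auto simp: precrossed_def image_group_carrier inv_into_f_f[OF inj_TBase]
        G.conj_by_mult_left)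
next
  case (Suc k)
  then show ?case using tens_pow_precrossed_step assms by blast
qed

context
  fixes H :: "'c monoid" and G :: "'a monoid" and f
  assumes H: "group H" and G: "group G" and f: "f \<in> hom H G"
begin

interpretation H: group H by (rule H)
interpretation G: group G by (rule G)

text \<open>Three properties of the induced map that need a common induction: the last two say that the map
  respects the actions from which the next tensor power is formed, and without them the next
  induced map would not be a homomorphism.\<close>

abbreviation tens_map_equivariant :: "nat \<Rightarrow> bool" where
  "tens_map_equivariant n \<equiv>
     tens_map H G f n \<in> hom (tens_pow H n) (tens_pow G n) \<and>
     (\<forall>t\<in>carrier (tens_pow H n). tens_lam G n (tens_map H G f n t) = f (tens_lam H n t)) \<and>
     (\<forall>h\<in>carrier H. \<forall>t\<in>carrier (tens_pow H n).
        tens_map H G f n (tens_act H n h t) = tens_act G n (f h) (tens_map H G f n t))"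

lemma tens_map_pairing:
  assumes "tens_map_equivariant (Suc k)"
  shows "tens_pow_pairing H (Suc k) (tens_step G (Suc k))
    (\<lambda>x h. tens_step_sym G (Suc k) (tens_map H G f (Suc k) x) (f h))"
proof (rule tensor_pairing_pullback[OF tens_step_sym_pairing[OF G tens_pow_precrossed[OF G]]])
  fix m x assume m: "m \<in> carrier (tens_pow H (Suc k))" and x: "x \<in> carrier H"
  have "tens_lam H (Suc k) m \<in> carrier H"
    using lam_hom[OF H tens_pow_precrossed[OF H]] m by (rule hom_in_carrier)
  then show "f (conj_by H (tens_lam H (Suc k) m) x) =
      conj_by G (tens_lam G (Suc k) (tens_map H G f (Suc k) m)) (f x)"
    using assms m x hom_conj_by[OF f H G] by simp
qed (use assms H G f tens_pow_precrossed[OF H, of k] tens_pow_precrossed[OF G, of k]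
    in \<open>auto simp: precrossed_def\<close>)

lemma tens_map_lift:
  "tens_map H G f (Suc (Suc k)) = (\<lambda>t. tlabel (tens_pow_lift H (Suc k) (tens_step G (Suc k))
    (\<lambda>x h. tens_step_sym G (Suc k) (tens_map H G f (Suc k) x) (f h)) t))"
  by (rule HOL.ext) (simp only: tens_map.simps tens_pow_lift_def)

lemma tens_map_Suc_hom:
  assumes "tens_map_equivariant (Suc k)"
  shows "tens_map H G f (Suc (Suc k)) \<in> hom (tens_pow H (Suc (Suc k))) (tens_pow G (Suc (Suc k)))"
  unfolding tens_map_lift
  using hom_compose[OF tens_pow_lift_hom[OF H tens_pow_precrossed[OF H] tens_step_group
      tens_map_pairing[OF assms]] tlabel_hom]
  by (simp add: comp_def)

lemma tens_map_sym_step: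
  assumes "tens_map_equivariant (Suc k)" "x \<in> carrier (tens_pow H (Suc k))" "h \<in> carrier H"
  shows "tens_map H G f (Suc (Suc k)) (tens_pow_sym H (Suc k) x h) =
    tens_pow_sym G (Suc k) (tens_map H G f (Suc k) x) (f h)"
  unfolding tens_map_lift
  using assms(2,3) by (simp add: tens_pow_lift_sym[OF H tens_pow_precrossed[OF H] tens_step_group
      tens_map_pairing[OF assms(1)]] tens_pow_sym_def[of G])

lemma tens_map_equivariant: "tens_map_equivariant (Suc k)"
proof (induction k)
  case 0
  have "(\<lambda>t. TBase (f (inv_into (carrier H) TBase t))) \<in> hom (image_group TBase H) (image_group TBase G)"
    using image_group_lift[OF inj_TBase hom_compose[OF f image_group_label[OF inj_TBase]] H] by simp
  then show ?case
    using hom_in_carrier[OF f]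
    by (auto simp: image_group_carrier inv_into_f_f[OF inj_TBase] hom_conj_by[OF f H G])
next
  case (Suc k)
  note pcH = tens_pow_precrossed[OF H, of k] and pcG = tens_pow_precrossed[OF G, of k]
    and sym = tens_map_sym_step[OF Suc.IH] and map_hom = tens_map_Suc_hom[OF Suc.IH]
    and heq = tens_pow_hom_eq[OF H tens_pow_precrossed[OF H, of k]]
  note mclosed = hom_in_carrier[OF conjunct1[OF Suc.IH]] and fclosed = hom_in_carrier[OF f]
  note lclosed = hom_in_carrier[OF lam_hom[OF H pcH]]
    and aclosed = tens_step_actions_closed(2)[OF H pcH]
  show ?case
  proof (intro conjI ballI)
    show "tens_map H G f (Suc (Suc k)) \<in> hom (tens_pow H (Suc (Suc k))) (tens_pow G (Suc (Suc k)))"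
      by (rule map_hom)
    fix t assume t: "t \<in> carrier (tens_pow H (Suc (Suc k)))"
    have "(tens_lam G (Suc (Suc k)) \<circ> tens_map H G f (Suc (Suc k))) t = (f \<circ> tens_lam H (Suc (Suc k))) t"
    proof (rule heq[OF G _ _ _ t])
      show "tens_lam G (Suc (Suc k)) \<circ> tens_map H G f (Suc (Suc k)) \<in> hom (tens_pow H (Suc (Suc k))) G"
        using hom_compose[OF map_hom tens_lam_Suc_hom[OF G pcG]] .
      show "f \<circ> tens_lam H (Suc (Suc k)) \<in> hom (tens_pow H (Suc (Suc k))) G"
        using hom_compose[OF tens_lam_Suc_hom[OF H pcH] f] .
    next
      fix x h assume "x \<in> carrier (tens_pow H (Suc k))" "h \<in> carrier H"
      then show "(tens_lam G (Suc (Suc k)) \<circ> tens_map H G f (Suc (Suc k))) (tens_pow_sym H (Suc k) x h) =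
          (f \<circ> tens_lam H (Suc (Suc k))) (tens_pow_sym H (Suc k) x h)"
        using mclosed fclosed lclosed Suc.IH
        by (simp del: tens_map.simps tens_lam.simps add: sym tens_lam_sym[OF H pcH]
            tens_lam_sym[OF G pcG] hom_commutator[OF f H G])
    qed
    then show "tens_lam G (Suc (Suc k)) (tens_map H G f (Suc (Suc k)) t) = f (tens_lam H (Suc (Suc k)) t)"
      by (simp del: tens_map.simps tens_lam.simps)
  next
    fix g t assume g: "g \<in> carrier H" and t: "t \<in> carrier (tens_pow H (Suc (Suc k)))"
    have "(tens_map H G f (Suc (Suc k)) \<circ> tens_act H (Suc (Suc k)) g) t =
      (tens_act G (Suc (Suc k)) (f g) \<circ> tens_map H G f (Suc (Suc k))) t"
    proof (rule heq[OF tens_pow_Suc_group _ _ _ t])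
      show "tens_map H G f (Suc (Suc k)) \<circ> tens_act H (Suc (Suc k)) g
          \<in> hom (tens_pow H (Suc (Suc k))) (tens_pow G (Suc (Suc k)))"
        using hom_compose[OF tens_act_Suc_hom[OF H pcH g] map_hom] .
      show "tens_act G (Suc (Suc k)) (f g) \<circ> tens_map H G f (Suc (Suc k))
          \<in> hom (tens_pow H (Suc (Suc k))) (tens_pow G (Suc (Suc k)))"
        using hom_compose[OF map_hom tens_act_Suc_hom[OF G pcG fclosed[OF g]]] .
    next
      fix x h assume "x \<in> carrier (tens_pow H (Suc k))" "h \<in> carrier H"
      then show "(tens_map H G f (Suc (Suc k)) \<circ> tens_act H (Suc (Suc k)) g) (tens_pow_sym H (Suc k) x h) =
          (tens_act G (Suc (Suc k)) (f g) \<circ> tens_map H G f (Suc (Suc k))) (tens_pow_sym H (Suc k) x h)"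
        using mclosed fclosed lclosed aclosed g Suc.IH
        by (simp del: tens_map.simps tens_act.simps add: sym tens_act_sym[OF H pcH]
            tens_act_sym[OF G pcG] hom_conj_by[OF f H G])
    qed
    then show "tens_map H G f (Suc (Suc k)) (tens_act H (Suc (Suc k)) g t) =
        tens_act G (Suc (Suc k)) (f g) (tens_map H G f (Suc (Suc k)) t)"
      by (simp del: tens_map.simps tens_act.simps)
  qed
qed

lemmas tens_map_sym = tens_map_sym_step[OF tens_map_equivariant]

lemma tens_map_hom: "tens_map H G f (Suc k) \<in> hom (tens_pow H (Suc k)) (tens_pow G (Suc k))"
  using tens_map_equivariant by blast

end

section \<open>Exterior powers\<close>

text \<open>The exterior powers are iterated squares with conjugation actions, which every homomorphism
  respects. So there is no action to be carried along, and each of the steps only depends on the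
  universal property of the exterior square.\<close>

definition ext_pow_sym :: "'a monoid \<Rightarrow> nat \<Rightarrow> 'a epow \<Rightarrow> 'a epow \<Rightarrow> 'a epow" where
  "ext_pow_sym G n x y = elabel (wedge_sym (ext_pow G n) x y)"

definition ext_pow_lift ::
    "'a monoid \<Rightarrow> nat \<Rightarrow> ('k, 'l) monoid_scheme \<Rightarrow> ('a epow \<Rightarrow> 'a epow \<Rightarrow> 'k) \<Rightarrow> 'a epow \<Rightarrow> 'k" where
  "ext_pow_lift G n K \<phi> t =
     wedge_lift K \<phi> (inv_into (carrier (exterior_square (ext_pow G n))) elabel t)"

lemma ext_pow_group:
  assumes "group G" shows "group (ext_pow G (Suc k))"
proof (induction k)
  case 0
  show ?case using group.inj_imp_image_group_is_group[OF assms inj_EBase] by simp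
next
  case (Suc k)
  show ?case
    using group.inj_imp_image_group_is_group[OF exterior_square_group[OF Suc.IH]
        inj_elabel[OF Suc.IH]] by simp
qed

context
  fixes G :: "'a monoid" and k :: nat
  assumes G: "group G"
begin

interpretation G: group G by (rule G)

lemma elabel_hom: "elabel \<in> hom (exterior_square (ext_pow G (Suc k))) (ext_pow G (Suc (Suc k)))"
  using image_group_label[OF inj_elabel[OF ext_pow_group[OF G]]] by simp

lemma ext_pow_sym_closed:
  assumes "x \<in> carrier (ext_pow G (Suc k))" "y \<in> carrier (ext_pow G (Suc k))"
  shows "ext_pow_sym G (Suc k) x y \<in> carrier (ext_pow G (Suc (Suc k)))"
  unfolding ext_pow_sym_def
  using hom_in_carrier[OF elabel_hom] assms
    tensor_pairing_closed[OF wedge_pairing_tensor[OF wedge_sym_pairing[OF ext_pow_group[OF G]]]]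
  by blast

lemma ext_pow_generated:
  "carrier (ext_pow G (Suc (Suc k))) = generate (ext_pow G (Suc (Suc k)))
     {ext_pow_sym G (Suc k) x y |x y.
        x \<in> carrier (ext_pow G (Suc k)) \<and> y \<in> carrier (ext_pow G (Suc k))}"
proof -
  let ?M = "ext_pow G (Suc k)"
  let ?X = "{wedge_sym ?M x y |x y. x \<in> carrier ?M \<and> y \<in> carrier ?M}"
  note M = ext_pow_group[OF G, of k]
  have X: "?X \<subseteq> carrier (exterior_square ?M)"
    by (auto intro: tensor_pairing_closed[OF wedge_pairing_tensor[OF wedge_sym_pairing[OF M]]])
  have "elabel ` ?X = {ext_pow_sym G (Suc k) x y |x y. x \<in> carrier ?M \<and> y \<in> carrier ?M}"
    unfolding ext_pow_sym_def by blast
  then show ?thesis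
    using image_group_generated[OF inj_elabel[OF M] exterior_square_group[OF M] X
        exterior_square_generated[OF M]] by simp
qed

lemma ext_pow_lift_hom:
  assumes "group K" "wedge_pairing (ext_pow G (Suc k)) K \<phi>"
  shows "ext_pow_lift G (Suc k) K \<phi> \<in> hom (ext_pow G (Suc (Suc k))) K"
proof -
  note M = ext_pow_group[OF G, of k]
  show ?thesis
    using image_group_lift[OF inj_elabel[OF M] wedge_lift_hom[OF M assms] exterior_square_group[OF M]]
    unfolding ext_pow_lift_def[abs_def] by simp
qed

lemma ext_pow_lift_sym:
  assumes "group K" "wedge_pairing (ext_pow G (Suc k)) K \<phi>"
    and "x \<in> carrier (ext_pow G (Suc k))" "y \<in> carrier (ext_pow G (Suc k))"
  shows "ext_pow_lift G (Suc k) K \<phi> (ext_pow_sym G (Suc k) x y) = \<phi> x y"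
proof -
  note M = ext_pow_group[OF G, of k]
  have "wedge_sym (ext_pow G (Suc k)) x y \<in> carrier (exterior_square (ext_pow G (Suc k)))"
    using assms(3,4) by (rule tensor_pairing_closed[OF wedge_pairing_tensor[OF wedge_sym_pairing[OF M]]])
  then show ?thesis
    using wedge_lift_sym[OF M assms]
    unfolding ext_pow_lift_def ext_pow_sym_def by (simp add: inv_into_f_f[OF inj_elabel[OF M]])
qed

end

lemma ext_mu_lift:
  "ext_mu G (Suc (Suc k)) = ext_pow_lift G (Suc k) G
    (\<lambda>x y. commutator G (ext_mu G (Suc k) x) (ext_mu G (Suc k) y))"
  by (rule ext) (simp only: ext_mu.simps ext_pow_lift_def)

lemma ext_mu_pairing:
  assumes G: "group G" and mu: "ext_mu G (Suc k) \<in> hom (ext_pow G (Suc k)) G"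
  shows "wedge_pairing (ext_pow G (Suc k)) G
    (\<lambda>x y. commutator G (ext_mu G (Suc k) x) (ext_mu G (Suc k) y))"
proof -
  note M = ext_pow_group[OF G, of k]
  have "tensor_pairing (ext_pow G (Suc k)) (ext_pow G (Suc k)) (conj_by (ext_pow G (Suc k)))
    (conj_by (ext_pow G (Suc k))) G
    (\<lambda>x y. commutator G (ext_mu G (Suc k) x) (ext_mu G (Suc k) y))"
    by (rule commutator_pairing[OF G M mu M mu]) (rule hom_conj_by[OF mu M G]; assumption)+
  then show ?thesis
    using hom_in_carrier[OF mu] group.commutator_self[OF G] by (simp add: wedge_pairing_def)
qed

lemma ext_mu_hom:
  assumes G: "group G" shows "ext_mu G (Suc k) \<in> hom (ext_pow G (Suc k)) G"
proof (induction k)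
  case 0
  show ?case using image_group_lift[OF inj_EBase, of "\<lambda>g. g" G G] assms by (simp add: hom_def)
next
  case (Suc k)
  show ?case
    unfolding ext_mu_lift by (rule ext_pow_lift_hom[OF G G ext_mu_pairing[OF G Suc.IH]])
qed

lemma ext_mu_sym:
  assumes "group G" "x \<in> carrier (ext_pow G (Suc k))" "y \<in> carrier (ext_pow G (Suc k))"
  shows "ext_mu G (Suc (Suc k)) (ext_pow_sym G (Suc k) x y) =
    commutator G (ext_mu G (Suc k) x) (ext_mu G (Suc k) y)"
  unfolding ext_mu_lift
  using ext_pow_lift_sym[OF assms(1,1) ext_mu_pairing[OF assms(1) ext_mu_hom[OF assms(1)]] assms(2,3)] .

lemma ext_map_lift:
  "ext_map H G f (Suc (Suc k)) = (\<lambda>t. elabel (ext_pow_lift H (Suc k) (exterior_square (ext_pow G (Suc k)))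
    (\<lambda>x y. wedge_sym (ext_pow G (Suc k)) (ext_map H G f (Suc k) x) (ext_map H G f (Suc k) y)) t))"
  by (rule ext) (simp only: ext_map.simps ext_pow_lift_def)

lemma ext_map_pairing:
  assumes H: "group H" and G: "group G"
    and map: "ext_map H G f (Suc k) \<in> hom (ext_pow H (Suc k)) (ext_pow G (Suc k))"
  shows "wedge_pairing (ext_pow H (Suc k)) (exterior_square (ext_pow G (Suc k)))
    (\<lambda>x y. wedge_sym (ext_pow G (Suc k)) (ext_map H G f (Suc k) x) (ext_map H G f (Suc k) y))"
proof -
  note MH = ext_pow_group[OF H, of k] and MG = ext_pow_group[OF G, of k]
  have "tensor_pairing (ext_pow H (Suc k)) (ext_pow H (Suc k)) (conj_by (ext_pow H (Suc k)))
    (conj_by (ext_pow H (Suc k))) (exterior_square (ext_pow G (Suc k)))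
    (\<lambda>x y. wedge_sym (ext_pow G (Suc k)) (ext_map H G f (Suc k) x) (ext_map H G f (Suc k) y))"
    by (rule tensor_pairing_pullback[OF wedge_pairing_tensor[OF wedge_sym_pairing[OF MG]]
          MH MG map MH MG map]) (rule hom_conj_by[OF map MH MG]; assumption)+
  then show ?thesis
    using hom_in_carrier[OF map] wedge_sym_pairing[OF MG] by (simp add: wedge_pairing_def)
qed

lemma ext_map_hom:
  assumes H: "group H" and G: "group G" and f: "f \<in> hom H G"
  shows "ext_map H G f (Suc k) \<in> hom (ext_pow H (Suc k)) (ext_pow G (Suc k))"
proof (induction k)
  case 0
  show ?case
    using image_group_lift[OF inj_EBase hom_compose[OF f image_group_label[OF inj_EBase]] H] by simp
next
  case (Suc k)
  show ?case
    unfolding ext_map_lift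
    using hom_compose[OF ext_pow_lift_hom[OF H exterior_square_group[OF ext_pow_group[OF G]]
          ext_map_pairing[OF H G Suc.IH]] elabel_hom[OF G]]
    by (simp add: comp_def)
qed

lemma ext_map_sym:
  assumes H: "group H" and G: "group G" and f: "f \<in> hom H G"
    and "x \<in> carrier (ext_pow H (Suc k))" "y \<in> carrier (ext_pow H (Suc k))"
  shows "ext_map H G f (Suc (Suc k)) (ext_pow_sym H (Suc k) x y) =
    ext_pow_sym G (Suc k) (ext_map H G f (Suc k) x) (ext_map H G f (Suc k) y)"
  unfolding ext_map_lift
  using assms(4,5)
  by (simp add: ext_pow_lift_sym[OF H exterior_square_group[OF ext_pow_group[OF G]]
        ext_map_pairing[OF H G ext_map_hom[OF H G f]]] ext_pow_sym_def[of G])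

section \<open>Central series, derived series and centralizers modulo a subgroup\<close>

text \<open>The preimage of the centralizer of the image of \<open>C\<close> in the quotient by \<open>N\<close>. The upper central
  series and the chain that leads to \<open>\<DD>\<^sub>k\<close> arise by iterating this construction.\<close>

definition centralizer_mod :: "('a, 'b) monoid_scheme \<Rightarrow> 'a set \<Rightarrow> 'a set \<Rightarrow> 'a set" where
  "centralizer_mod G N C = {g \<in> carrier G. \<forall>x\<in>C. commutator G g x \<in> N}"

lemma (in group) centralizer_mod_normal:
  assumes "N \<lhd> G" "C \<lhd> G" shows "centralizer_mod G N C \<lhd> G"
proof -
  interpret N: normal N G by fact
  interpret C: normal C G by fact
  show ?thesis
  proof (rule normalI_conj)
    show "subgroup (centralizer_mod G N C) G"
    proof
      show "centralizer_mod G N C \<subseteq> carrier G" by (auto simp: centralizer_mod_def)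
      show "\<one> \<in> centralizer_mod G N C"
        by (auto simp: centralizer_mod_def commutator_def)
    next
      fix g h assume "g \<in> centralizer_mod G N C" "h \<in> centralizer_mod G N C"
      moreover from this have "commutator G (g \<otimes> h) x =
          conj_by G g (commutator G h x) \<otimes> commutator G g x" if "x \<in> C" for x
        using that by (simp add: centralizer_mod_def word_simps)
      ultimately show "g \<otimes> h \<in> centralizer_mod G N C"
        by (auto simp: centralizer_mod_def N.conj_by_mem)
    next
      fix g assume "g \<in> centralizer_mod G N C"
      moreover from this have "commutator G (inv g) x =
          conj_by G (inv g) (inv (commutator G g x))" if "x \<in> C" for x
        using that by (simp add: centralizer_mod_def word_simps)
      ultimately show "inv g \<in> centralizer_mod G N C"
        by (auto simp: centralizer_mod_def N.conj_by_mem)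
    qed
  next
    fix h g assume "h \<in> carrier G" "g \<in> centralizer_mod G N C"
    moreover from this have "commutator G (conj_by G h g) x =
        conj_by G h (commutator G g (conj_by G (inv h) x))" if "x \<in> C" for x
      using that by (simp add: centralizer_mod_def word_simps)
    ultimately show "conj_by G h g \<in> centralizer_mod G N C"
      by (auto simp: centralizer_mod_def N.conj_by_mem C.conj_by_mem)
  qed
qed

lemma (in normal) commutator_mem_swap:
  "\<lbrakk>x \<in> carrier G; y \<in> carrier G; commutator G x y \<in> H\<rbrakk> \<Longrightarrow> commutator G y x \<in> H"
  using inv_commutator[of x y] m_inv_closed by metis

lemma (in normal) commutator_mem:
  "\<lbrakk>x \<in> H; y \<in> carrier G\<rbrakk> \<Longrightarrow> commutator G x y \<in> H"
proof -
  assume a: "x \<in> H" "y \<in> carrier G"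
  then have "commutator G x y = x \<otimes> conj_by G y (inv x)" by (simp add: word_simps)
  with a show ?thesis by (simp add: conj_by_mem)
qed

text \<open>Modulo a normal subgroup, a right factor of an entry whose own commutator with the other entry is
  trivial can be dropped.\<close>

lemma (in normal) rcoset_commutator_left:
  assumes "x \<in> carrier G" "e \<in> carrier G" "y \<in> carrier G" "commutator G e y \<in> H"
  shows "H #> commutator G (x \<otimes> e) y = H #> commutator G x y"
proof -
  have "commutator G (x \<otimes> e) y = conj_by G x (commutator G e y) \<otimes> commutator G x y"
    using assms(1-3) by (simp add: word_simps)
  then show ?thesis using assms by (simp add: rcoset_mult_left conj_by_mem)
qed

lemma (in normal) rcoset_commutator_right:
  assumes "x \<in> carrier G" "y \<in> carrier G" "e \<in> carrier G" "commutator G x e \<in> H"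
  shows "H #> commutator G x (y \<otimes> e) = H #> commutator G x y"
proof -
  have "commutator G x (y \<otimes> e) = commutator G x y \<otimes> conj_by G y (commutator G x e)"
    using assms(1-3) by (simp add: word_simps)
  then show ?thesis using assms by (simp add: rcoset_mult_right conj_by_mem)
qed

lemma (in normal) rcoset_eq_iff:
  assumes "x \<in> carrier G" "y \<in> carrier G"
  shows "H #> x = H #> y \<longleftrightarrow> x \<otimes> inv y \<in> H"
  using assms by (metis is_group rcos_module rcos_self is_subgroup repr_independence)

text \<open>Unfolding the recursion as a rewrite rule would turn each membership into a nested universal
  statement.\<close>

declare upper_central.simps(2) [simp del]

lemma upper_centralD:
  "\<lbrakk>z \<in> upper_central G (Suc k); x \<in> carrier G\<rbrakk> \<Longrightarrow> commutator G z x \<in> upper_central G k"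
  by (simp add: upper_central.simps(2))

lemma (in group) upper_central_normal: "upper_central G k \<lhd> G"
proof (induction k)
  case 0
  show ?case by (simp add: one_is_normal)
next
  case (Suc k)
  then show ?case
    using centralizer_mod_normal[OF Suc.IH normal_self] by (simp add: centralizer_mod_def upper_central.simps(2))
qed

lemma (in group) lower_central_normal: "lower_central G (Suc k) \<lhd> G"
proof (induction k)
  case 0
  show ?case by (simp add: normal_self)
next
  case (Suc k)
  interpret L: normal "lower_central G (Suc k)" G by fact
  show ?case
    unfolding lower_central.simps
  proof (rule generate_normal)
    fix g s assume g: "g \<in> carrier G"
      and "s \<in> {commutator G x y |x y. x \<in> lower_central G (Suc k) \<and> y \<in> carrier G}"
    then obtain x y where "x \<in> lower_central G (Suc k)" "y \<in> carrier G" "s = commutator G x y"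
      by blast
    with g have "conj_by G g s = commutator G (conj_by G g x) (conj_by G g y)"
      "conj_by G g x \<in> lower_central G (Suc k)" "conj_by G g y \<in> carrier G"
      by (simp_all add: conj_by_commutator L.conj_by_mem)
    then show "conj_by G g s \<in>
        {commutator G x y |x y. x \<in> lower_central G (Suc k) \<and> y \<in> carrier G}" by blast
  qed auto
qed

text \<open>The classical inclusion \<open>[\<gamma>\<^sub>k, Z\<^sub>m\<^sub>+\<^sub>k] \<subseteq> Z\<^sub>m\<close>. For \<open>k + 1\<close> it is enough to treat the generators
  \<open>[u, v]\<close> of \<open>\<gamma>\<^sub>k\<^sub>+\<^sub>1\<close>, since the elements that commute with all of \<open>Z\<^sub>m\<^sub>+\<^sub>k\<^sub>+\<^sub>1\<close> modulo \<open>Z\<^sub>m\<close> form a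
  subgroup. Conjugation by \<open>w\<close> turns \<open>u\<close> into \<open>u c\<close> and \<open>v\<close> into \<open>v d\<close>, where \<open>c = [u\<inverse>, w]\<close> is central
  modulo \<open>Z\<^sub>m\<close> and \<open>d = [v\<inverse>, w]\<close> commutes with \<open>u\<close> modulo \<open>Z\<^sub>m\<close>, both by induction. So \<open>[u c, v d]\<close>
  and \<open>[u, v]\<close> agree modulo \<open>Z\<^sub>m\<close>, which says that \<open>w\<close> commutes with \<open>[u, v]\<close> there. This takes the place
  of the three subgroups lemma.\<close>

lemma (in group) lower_upper_commutator:
  "\<lbrakk>x \<in> lower_central G (Suc k); z \<in> upper_central G (m + Suc k)\<rbrakk>
    \<Longrightarrow> commutator G x z \<in> upper_central G m"
proof (induction k arbitrary: m x z)
  case 0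
  interpret Z: normal "upper_central G m" G by (rule upper_central_normal)
  interpret Z': normal "upper_central G (Suc m)" G by (rule upper_central_normal)
  show ?case
    using 0 upper_centralD[of z G m x] Z.commutator_mem_swap[of z x] Z'.mem_carrier by simp
next
  case (Suc k)
  let ?N = "upper_central G m" and ?Z = "upper_central G (m + Suc (Suc k))"
  interpret N: normal ?N G by (rule upper_central_normal)
  interpret Z: normal ?Z G by (rule upper_central_normal)
  interpret L: normal "lower_central G (Suc k)" G by (rule lower_central_normal)
  interpret C: normal "centralizer_mod G ?N ?Z" G
    by (rule centralizer_mod_normal[OF upper_central_normal upper_central_normal])
  have "commutator G u v \<in> centralizer_mod G ?N ?Z"
    if u: "u \<in> lower_central G (Suc k)" and v: "v \<in> carrier G" for u v
  proof -
    have "commutator G (commutator G u v) w \<in> ?N" if w: "w \<in> ?Z" for w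
    proof -
      have u': "u \<in> carrier G" and w': "w \<in> carrier G" using u w by (simp_all add: L.mem_carrier Z.mem_carrier)
      \<comment> \<open>\<open>w u w\<inverse> = u c\<close> and \<open>w v w\<inverse> = v d\<close>\<close>
      let ?c = "commutator G (inv u) w" and ?d = "commutator G (inv v) w"
      have c: "commutator G ?c y \<in> ?N" if "y \<in> carrier G" for y
      proof (rule upper_centralD[OF _ that])
        have "w \<in> upper_central G (Suc m + Suc k)" using w by simp
        then show "?c \<in> upper_central G (Suc m)" using u Suc.IH L.m_inv_closed by blast
      qed
      have "commutator G w (inv v) \<in> upper_central G (m + Suc k)"
        using upper_centralD[of w G "m + Suc k"] w v by simp
      then have "?d \<in> upper_central G (m + Suc k)"
        using normal.commutator_mem_swap[OF upper_central_normal] w' v by simp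
      then have d: "commutator G u ?d \<in> ?N" using Suc.IH u by blast
      have "conj_by G w (commutator G u v) = commutator G (u \<otimes> ?c) (v \<otimes> ?d)"
        using u' v w' by (simp add: word_simps)
      then have "?N #> conj_by G w (commutator G u v) = ?N #> commutator G u v"
        using u' v w' c d by (simp add: N.rcoset_commutator_left N.rcoset_commutator_right)
      then have "conj_by G w (commutator G u v) \<otimes> inv (commutator G u v) \<in> ?N"
        using u' v w' by (simp add: N.rcoset_eq_iff)
      moreover have "conj_by G w (commutator G u v) \<otimes> inv (commutator G u v) =
          commutator G w (commutator G u v)" by (simp add: conj_by_def commutator_def)
      ultimately show ?thesis using N.commutator_mem_swap u' v w' by simp
    qed
    then show ?thesis
      unfolding centralizer_mod_def using commutator_closed[OF L.mem_carrier[OF u] v] by blast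
  qed
  then have "lower_central G (Suc (Suc k)) \<subseteq> centralizer_mod G ?N ?Z"
    unfolding lower_central.simps by (intro generate_subgroup_incl C.subgroup_axioms) blast
  then show ?case using Suc.prems unfolding centralizer_mod_def by blast
qed

lemma (in group) derived_series_normal: "derived_series G (Suc k) \<lhd> G"
  unfolding derived_series_def
  by (induction k) (simp_all add: normal_self derived_is_normal)

lemma derived_series_Suc_Suc:
  "derived_series G (Suc (Suc k)) = generate G
    {commutator G x y |x y. x \<in> derived_series G (Suc k) \<and> y \<in> derived_series G (Suc k)}"
proof -
  have "{commutator G x y |x y. x \<in> D \<and> y \<in> D} = derived_set G D" for D
    by (auto simp: commutator_def)
  then show ?thesis by (simp add: derived_series_def derived_def)
qed

text \<open>The set of all \<open>g\<close> with \<open>[\<dots>[g, x\<^sub>j], \<dots>, x\<^sub>j\<^sub>+\<^sub>r\<^sub>-\<^sub>1] = 1\<close> for all \<open>x\<^sub>i\<close> in the \<open>i\<close>-th term of the derived series. The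
  recursion splits off the innermost commutator, which exhibits these sets as iterated centralizers
  and hence as normal subgroups.\<close>

fun frak_chain :: "('a, 'b) monoid_scheme \<Rightarrow> nat \<Rightarrow> nat \<Rightarrow> 'a set" where
  "frak_chain G j 0 = {\<one>\<^bsub>G\<^esub>}"
| "frak_chain G j (Suc r) = centralizer_mod G (frak_chain G (Suc j) r) (derived_series G j)"

lemma (in group) frak_chain_normal: "frak_chain G (Suc j) r \<lhd> G"
  by (induction r arbitrary: j)
    (auto simp: one_is_normal intro: centralizer_mod_normal derived_series_normal)

text \<open>The iterated commutator is defined by splitting off the outermost commutator; to compare it with
  the chain, the innermost one is needed.\<close>

lemma iter_commutator_shift:
  "iter_commutator G g x (Suc r) = iter_commutator G (commutator G g (x (Suc 0))) (\<lambda>i. x (Suc i)) r"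
  by (induction r) simp_all

lemma iter_commutator_cong:
  "(\<And>i. i \<in> {1..r} \<Longrightarrow> x i = y i) \<Longrightarrow> iter_commutator G g x r = iter_commutator G g y r"
  by (induction r) simp_all

lemma (in group) mem_frak_chain:
  assumes "g \<in> carrier G"
    and "\<And>x. (\<And>i. i \<in> {1..r} \<Longrightarrow> x i \<in> derived_series G (j + i)) \<Longrightarrow> iter_commutator G g x r = \<one>"
  shows "g \<in> frak_chain G (Suc j) r"
  using assms
proof (induction r arbitrary: g j)
  case 0
  then show ?case by simp
next
  case (Suc r)
  have "commutator G g y \<in> frak_chain G (Suc (Suc j)) r" if y: "y \<in> derived_series G (Suc j)" for y
  proof (rule Suc.IH)
    show "commutator G g y \<in> carrier G"
      using Suc.prems(1) y normal_imp_subgroup[OF derived_series_normal] subgroup.mem_carrier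
      by (metis commutator_closed)
    fix x assume x: "\<And>i. i \<in> {1..r} \<Longrightarrow> x i \<in> derived_series G (Suc j + i)"
    \<comment> \<open>\<open>y\<close> put in front of the sequence \<open>x\<close>, which is numbered from 1\<close>
    let ?x = "\<lambda>i. if i = Suc 0 then y else x (i - 1)"
    have "?x i \<in> derived_series G (j + i)" if "i \<in> {1..Suc r}" for i
      using that y x[of "i - 1"] by (cases "i = 1") (auto simp: Suc_le_eq)
    then have "iter_commutator G g ?x (Suc r) = \<one>" by (rule Suc.prems(2))
    moreover have "iter_commutator G (commutator G g y) (\<lambda>i. ?x (Suc i)) r =
        iter_commutator G (commutator G g y) x r" by (rule iter_commutator_cong) auto
    ultimately show "iter_commutator G (commutator G g y) x r = \<one>"
      unfolding iter_commutator_shift by simp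
  qed
  then show ?case using Suc.prems(1) by (simp add: centralizer_mod_def)
qed

lemma (in group) frak_D_subset_frak_chain: "frak_D G r \<subseteq> frak_chain G (Suc 0) r"
  by (auto simp: frak_D_def intro!: mem_frak_chain)

section \<open>Homomorphisms into a quotient, with cosets as values\<close>

lemma (in normal) mem_rcosetI: "x \<in> carrier G \<Longrightarrow> x \<in> H #> x"
  by (rule rcos_self[OF _ is_subgroup])

lemma (in normal) conj_by_rcoset:
  assumes "y \<in> carrier G" "x \<in> carrier G" "x' \<in> H #> x"
  shows "conj_by G y x' \<in> H #> conj_by G y x"
proof -
  obtain e where e: "e \<in> H" "x' = e \<otimes> x" using assms(3) by (auto simp: r_coset_def)
  then have "conj_by G y x' = conj_by G y e \<otimes> conj_by G y x"
    using assms by (simp add: conj_by_mult)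
  then show ?thesis using e assms conj_by_mem by (auto simp: r_coset_def)
qed

text \<open>A homomorphism into the quotient of \<open>K\<close> by \<open>N\<close> is treated as a homomorphism to \<open>K\<close> with several values:
  the values at \<open>m\<close> are the elements of the coset \<open>l m\<close>. This makes it possible to form commutators
  of values that are known modulo different normal subgroups.\<close>

locale coset_lift = M: group M + K: normal N K
  for M :: "'m monoid" and N :: "'k set" and K :: "'k monoid" +
  fixes l :: "'m \<Rightarrow> 'k set"
  assumes l_hom: "l \<in> hom M (K Mod N)"
begin

sublocale q: group_hom M "K Mod N" l
  using l_hom K.factorgroup_is_group
  by (simp add: group_hom_def group_hom_axioms_def M.group_axioms)

lemma value_eq:
  assumes "m \<in> carrier M" "u \<in> l m"
  shows "u \<in> carrier K" "l m = N #>\<^bsub>K\<^esub> u"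
proof -
  have "l m \<in> carrier (K Mod N)" using assms(1) by simp
  then obtain v where v: "v \<in> carrier K" "l m = N #>\<^bsub>K\<^esub> v" by (auto simp: carrier_FactGroup)
  with assms(2) show "u \<in> carrier K" by (auto simp: r_coset_def)
  show "l m = N #>\<^bsub>K\<^esub> u" using K.repr_independence[OF _ v(1) K.is_subgroup] v(2) assms(2) by simp
qed

lemma value_exists:
  assumes "m \<in> carrier M" obtains u where "u \<in> l m"
proof -
  have "l m \<in> carrier (K Mod N)" using assms by simp
  then obtain v where "v \<in> carrier K" "l m = N #>\<^bsub>K\<^esub> v" by (auto simp: carrier_FactGroup)
  then show ?thesis using that K.mem_rcosetI by blast
qed

lemma value_one: "l \<one>\<^bsub>M\<^esub> = N"
  using q.hom_one by simp

lemma value_mult: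
  assumes "m \<in> carrier M" "u \<in> l m" "m' \<in> carrier M" "u' \<in> l m'"
  shows "u \<otimes>\<^bsub>K\<^esub> u' \<in> l (m \<otimes>\<^bsub>M\<^esub> m')"
proof -
  note u = value_eq[OF assms(1,2)] and u' = value_eq[OF assms(3,4)]
  have "l (m \<otimes>\<^bsub>M\<^esub> m') = N #>\<^bsub>K\<^esub> (u \<otimes>\<^bsub>K\<^esub> u')"
    using assms u u' by (simp add: K.rcos_sum)
  then show ?thesis using u u' K.mem_rcosetI by simp
qed

lemma value_inv:
  assumes "m \<in> carrier M" "u \<in> l m"
  shows "inv\<^bsub>K\<^esub> u \<in> l (inv\<^bsub>M\<^esub> m)"
proof -
  note u = value_eq[OF assms]
  have "l m \<in> carrier (K Mod N)" using assms(1) by simp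
  then have "l (inv\<^bsub>M\<^esub> m) = N #>\<^bsub>K\<^esub> (inv\<^bsub>K\<^esub> u)"
    using assms u by (simp add: K.inv_FactGroup K.rcos_inv)
  then show ?thesis using u K.mem_rcosetI by simp
qed

lemma value_conj_by:
  assumes "m \<in> carrier M" "u \<in> l m" "m' \<in> carrier M" "u' \<in> l m'"
  shows "conj_by K u u' \<in> l (conj_by M m m')"
  using assms unfolding conj_by_def by (intro value_mult value_inv M.m_closed M.inv_closed)

lemma values_subgroup: "subgroup (\<Union>(l ` carrier M)) K"
proof
  show "\<Union>(l ` carrier M) \<subseteq> carrier K" using value_eq by blast
  show "\<one>\<^bsub>K\<^esub> \<in> \<Union>(l ` carrier M)"
    using value_one subgroup.one_closed[OF K.is_subgroup] M.one_closed by blast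
  fix u assume "u \<in> \<Union>(l ` carrier M)"
  then obtain m where m: "m \<in> carrier M" "u \<in> l m" by blast
  then show "inv\<^bsub>K\<^esub> u \<in> \<Union>(l ` carrier M)" using value_inv by blast
  fix u' assume "u' \<in> \<Union>(l ` carrier M)"
  then obtain m' where m': "m' \<in> carrier M" "u' \<in> l m'" by blast
  show "u \<otimes>\<^bsub>K\<^esub> u' \<in> \<Union>(l ` carrier M)"
    using value_mult[OF m m'] M.m_closed[OF m(1) m'(1)] by blast
qed

text \<open>A form of induction over generators for relations between elements and their values: a
  relation that respects the group operations and links each generator to one of its values links each element to one
  of its values.\<close>

lemma generated_value:
  assumes gen: "carrier M = generate M S" and S: "S \<subseteq> carrier M"
    and base: "\<And>s. s \<in> S \<Longrightarrow> \<exists>u\<in>l s. R s u"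
    and one: "R \<one>\<^bsub>M\<^esub> \<one>\<^bsub>K\<^esub>"
    and inv: "\<And>m u. \<lbrakk>m \<in> carrier M; u \<in> l m; R m u\<rbrakk> \<Longrightarrow> R (inv\<^bsub>M\<^esub> m) (inv\<^bsub>K\<^esub> u)"
    and mult: "\<And>m u m' u'. \<lbrakk>m \<in> carrier M; u \<in> l m; R m u; m' \<in> carrier M; u' \<in> l m'; R m' u'\<rbrakk>
      \<Longrightarrow> R (m \<otimes>\<^bsub>M\<^esub> m') (u \<otimes>\<^bsub>K\<^esub> u')"
    and m: "m \<in> carrier M"
  shows "\<exists>u\<in>l m. R m u"
  using m[unfolded gen]
proof induction
  case one
  then show ?case using assms(4) value_one subgroup.one_closed[OF K.is_subgroup] by blast
next
  case (incl s)
  then show ?case by (rule base)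
next
  case (inv s)
  then obtain u where "u \<in> l s" "R s u" using base by blast
  then show ?case using value_inv assms(5) S inv by blast
next
  case (eng m m')
  then have "m \<in> carrier M" "m' \<in> carrier M" using gen by auto
  then show ?case using eng value_mult mult by blast
qed

lemma precompose:
  assumes "group L" "h \<in> hom L M"
  shows "coset_lift L N K (\<lambda>x. l (h x))"
  using hom_compose[OF assms(2) l_hom] assms(1) K.normal_axioms
  by (simp add: coset_lift_def coset_lift_axioms_def comp_def)

end

text \<open>The commutator of a value of \<open>l\<close>, known modulo \<open>N\<close>, and a value of \<open>l'\<close>, known modulo \<open>N'\<close>, is
  well defined modulo \<open>P\<close> as soon as both ambiguities only contribute commutators in \<open>P\<close>.\<close>

locale coset_pairing =
  X: coset_lift M N K l + Y: coset_lift M' N' K l' + P: normal P K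
  for M :: "'m monoid" and M' :: "'n monoid" and N N' P and K :: "'k monoid" and l l' +
  assumes left: "\<And>e x y. \<lbrakk>e \<in> N; x \<in> carrier M'; y \<in> l' x\<rbrakk> \<Longrightarrow> commutator K e y \<in> P"
    and right: "\<And>m u e. \<lbrakk>m \<in> carrier M; u \<in> l m; e \<in> N'\<rbrakk> \<Longrightarrow> commutator K u e \<in> P"
begin

definition pairing :: "'m \<Rightarrow> 'n \<Rightarrow> 'k set" where
  "pairing m x = P #>\<^bsub>K\<^esub> commutator K (SOME u. u \<in> l m) (SOME y. y \<in> l' x)"

lemma pairing_eq:
  assumes m: "m \<in> carrier M" "u \<in> l m" and x: "x \<in> carrier M'" "y \<in> l' x"
  shows "pairing m x = P #>\<^bsub>K\<^esub> commutator K u y"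
proof -
  define u0 y0 where "u0 = (SOME u. u \<in> l m)" and "y0 = (SOME y. y \<in> l' x)"
  have u0: "u0 \<in> l m" and y0: "y0 \<in> l' x"
    using m(2) x(2) unfolding u0_def y0_def by (metis someI)+
  note uc = X.value_eq[OF m] and u0c = X.value_eq[OF m(1) u0]
  note yc = Y.value_eq[OF x] and y0c = Y.value_eq[OF x(1) y0]
  obtain e where e: "e \<in> N" "u0 = u \<otimes>\<^bsub>K\<^esub> e" using X.K.rcoset_eqD u0c uc by metis
  obtain d where d: "d \<in> N'" "y0 = y \<otimes>\<^bsub>K\<^esub> d" using Y.K.rcoset_eqD y0c yc by metis
  have "P #>\<^bsub>K\<^esub> commutator K u0 y0 = P #>\<^bsub>K\<^esub> commutator K u y0"
    using P.rcoset_commutator_left[of u e y0] left[OF e(1) x(1) y0] e uc y0c by simp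
  also have "\<dots> = P #>\<^bsub>K\<^esub> commutator K u y"
    using P.rcoset_commutator_right[of u y d] right[OF m d(1)] d uc yc by simp
  finally show ?thesis by (simp add: pairing_def u0_def y0_def)
qed

lemma commutator_mem_pairing:
  "\<lbrakk>m \<in> carrier M; u \<in> l m; x \<in> carrier M'; y \<in> l' x\<rbrakk> \<Longrightarrow> commutator K u y \<in> pairing m x"
  using X.value_eq Y.value_eq P.mem_rcosetI by (simp add: pairing_eq)

lemma pairing_tensor:
  assumes a_closed: "\<And>m x. \<lbrakk>m \<in> carrier M; x \<in> carrier M'\<rbrakk> \<Longrightarrow> a m x \<in> carrier M'"
    and b_closed: "\<And>m x. \<lbrakk>m \<in> carrier M; x \<in> carrier M'\<rbrakk> \<Longrightarrow> b x m \<in> carrier M"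
    and a: "\<And>m u x y. \<lbrakk>m \<in> carrier M; u \<in> l m; x \<in> carrier M'; y \<in> l' x\<rbrakk>
      \<Longrightarrow> conj_by K u y \<in> l' (a m x)"
    and b: "\<And>m u x y. \<lbrakk>m \<in> carrier M; u \<in> l m; x \<in> carrier M'; y \<in> l' x\<rbrakk>
      \<Longrightarrow> conj_by K y u \<in> l (b x m)"
  shows "tensor_pairing M M' a b (K Mod P) pairing"
  unfolding tensor_pairing_def
proof (intro conjI ballI)
  fix m x assume m: "m \<in> carrier M" and x: "x \<in> carrier M'"
  obtain u y where u: "u \<in> l m" and y: "y \<in> l' x" using X.value_exists[OF m] Y.value_exists[OF x] by metis
  note uc = X.value_eq(1)[OF m u] and yc = Y.value_eq(1)[OF x y]
  show "pairing m x \<in> carrier (K Mod P)"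
    using uc yc by (simp add: pairing_eq[OF m u x y] carrier_FactGroup)
  {
    fix m' assume m': "m' \<in> carrier M"
    obtain u' where u': "u' \<in> l m'" using X.value_exists[OF m'] .
    note u'c = X.value_eq(1)[OF m' u']
    have "pairing (m \<otimes>\<^bsub>M\<^esub> m') x = P #>\<^bsub>K\<^esub> commutator K (u \<otimes>\<^bsub>K\<^esub> u') y"
      using pairing_eq[OF _ X.value_mult[OF m u m' u'] x y] m m' by simp
    moreover have "pairing (conj_by M m m') (a m x) = P #>\<^bsub>K\<^esub> commutator K (conj_by K u u') (conj_by K u y)"
      using pairing_eq[OF _ X.value_conj_by[OF m u m' u'] a_closed[OF m x] a[OF m u x y]] m m' by simp
    ultimately show "pairing (m \<otimes>\<^bsub>M\<^esub> m') x =
        pairing (conj_by M m m') (a m x) \<otimes>\<^bsub>K Mod P\<^esub> pairing m x"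
      using uc u'c yc by (simp add: pairing_eq[OF m u x y] P.rcos_sum X.K.commutator_mult_left)
  next
    fix x' assume x': "x' \<in> carrier M'"
    obtain y' where y': "y' \<in> l' x'" using Y.value_exists[OF x'] .
    note y'c = Y.value_eq(1)[OF x' y']
    have "pairing m (x \<otimes>\<^bsub>M'\<^esub> x') = P #>\<^bsub>K\<^esub> commutator K u (y \<otimes>\<^bsub>K\<^esub> y')"
      using pairing_eq[OF m u _ Y.value_mult[OF x y x' y']] x x' by simp
    moreover have "pairing (b x m) (conj_by M' x x') = P #>\<^bsub>K\<^esub> commutator K (conj_by K y u) (conj_by K y y')"
      using pairing_eq[OF b_closed[OF m x] b[OF m u x y] _ Y.value_conj_by[OF x y x' y']] x x' by simp
    ultimately show "pairing m (x \<otimes>\<^bsub>M'\<^esub> x') =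
        pairing m x \<otimes>\<^bsub>K Mod P\<^esub> pairing (b x m) (conj_by M' x x')"
      using uc y'c yc by (simp add: pairing_eq[OF m u x y] P.rcos_sum X.K.commutator_mult_right)
  }
qed

text \<open>A value of the induced homomorphism is a product of commutators of values and their inverses, up to
  a factor in \<open>P\<close>. As \<open>P\<close> lies in the subgroup generated by these commutators, nothing but this subgroup
  is obtained. Applied to the powers, this yields the next term of the lower central or the
  derived series.\<close>

lemma values_eq_generate:
  assumes T: "coset_lift T P K h"
    and gen: "carrier T = generate T {s m x |m x. m \<in> carrier M \<and> x \<in> carrier M'}"
    and s: "\<And>m x. \<lbrakk>m \<in> carrier M; x \<in> carrier M'\<rbrakk> \<Longrightarrow> s m x \<in> carrier T"
    and h: "\<And>m x. \<lbrakk>m \<in> carrier M; x \<in> carrier M'\<rbrakk> \<Longrightarrow> h (s m x) = pairing m x"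
    and P: "P \<subseteq> generate K
      {commutator K u y |u y. u \<in> \<Union>(l ` carrier M) \<and> y \<in> \<Union>(l' ` carrier M')}"
  shows "\<Union>(h ` carrier T) = generate K
      {commutator K u y |u y. u \<in> \<Union>(l ` carrier M) \<and> y \<in> \<Union>(l' ` carrier M')}"
    (is "_ = generate K ?C")
proof
  interpret T: coset_lift T P K h by fact
  have C: "?C \<subseteq> carrier K" using X.value_eq(1) Y.value_eq(1) by auto
  note G = X.K.generate_is_subgroup[OF C]
  show "generate K ?C \<subseteq> \<Union>(h ` carrier T)"
  proof (rule X.K.generate_subgroup_incl[OF _ T.values_subgroup])
    have "commutator K u y \<in> \<Union>(h ` carrier T)"
      if "m \<in> carrier M" "u \<in> l m" "x \<in> carrier M'" "y \<in> l' x" for m u x y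
      using commutator_mem_pairing[OF that] h[OF that(1,3)] s[OF that(1,3)] by blast
    then show "?C \<subseteq> \<Union>(h ` carrier T)" by blast
  qed
  show "\<Union>(h ` carrier T) \<subseteq> generate K ?C"
  proof
    fix v assume "v \<in> \<Union>(h ` carrier T)"
    then obtain t where t: "t \<in> carrier T" "v \<in> h t" by blast
    have "\<exists>u\<in>h t. u \<in> generate K ?C"
    proof (rule T.generated_value[OF gen _ _ _ _ _ t(1), where R = "\<lambda>_ u. u \<in> generate K ?C"])
      fix r assume "r \<in> {s m x |m x. m \<in> carrier M \<and> x \<in> carrier M'}"
      then obtain m x where m: "m \<in> carrier M" and x: "x \<in> carrier M'" and r: "r = s m x" by blast
      obtain u where u: "u \<in> l m" using X.value_exists[OF m] .
      obtain y where y: "y \<in> l' x" using Y.value_exists[OF x] .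
      have "commutator K u y \<in> ?C" using m x u y by blast
      then show "\<exists>u\<in>h r. u \<in> generate K ?C"
        using commutator_mem_pairing[OF m u x y] h[OF m x] r generate.incl[of _ ?C K] by blast
    qed (use s G in \<open>auto simp: subgroup.m_inv_closed subgroup.m_closed subgroup.one_closed\<close>)
    then obtain u where u: "u \<in> h t" "u \<in> generate K ?C" by blast
    then obtain e where "e \<in> P" "v = e \<otimes>\<^bsub>K\<^esub> u"
      using T.value_eq(2)[OF t(1) u(1)] t(2) by (auto simp: r_coset_def)
    then show "v \<in> generate K ?C" using P u(2) subgroup.m_closed[OF G] by blast
  qed
qed

end

text \<open>The inverse of the isomorphism from the quotient by the kernel: its cosets are the fibres.\<close>

lemma (in group_hom) fibre_lift:
  assumes "h ` carrier G = carrier H"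
  shows "(\<lambda>x. {y \<in> carrier G. h y = x}) \<in> hom H (G Mod kernel G H h)"
proof -
  have "kernel G H h \<lhd> G" by (rule normal_kernel)
  then interpret N: normal "kernel G H h" G .
  have fibre: "{y \<in> carrier G. h y = h z} = kernel G H h #> z" if z: "z \<in> carrier G" for z
  proof -
    have "y \<in> kernel G H h #> z \<longleftrightarrow> h y = h z" if y: "y \<in> carrier G" for y
    proof -
      have "y \<in> kernel G H h #> z \<longleftrightarrow> y \<otimes> inv z \<in> kernel G H h"
        by (rule N.rcos_module[OF G.is_group z y])
      also have "\<dots> \<longleftrightarrow> h y \<otimes>\<^bsub>H\<^esub> inv\<^bsub>H\<^esub> (h z) = \<one>\<^bsub>H\<^esub>"
        unfolding kernel_def using y z by simp
      also have "\<dots> \<longleftrightarrow> h y = h z"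
        using H.inv_solve_right'[of "\<one>\<^bsub>H\<^esub>" "h y" "h z"] y z by auto
      finally show ?thesis .
    qed
    moreover have "kernel G H h #> z \<subseteq> carrier G"
      using G.r_coset_subset_G[OF N.subset z] .
    ultimately show ?thesis by blast
  qed
  show ?thesis
  proof (rule homI)
    fix x assume "x \<in> carrier H"
    then obtain z where z: "z \<in> carrier G" "x = h z" using assms by blast
    then show "{y \<in> carrier G. h y = x} \<in> carrier (G Mod kernel G H h)"
      unfolding carrier_FactGroup using fibre by blast
    fix x' assume "x' \<in> carrier H"
    then obtain z' where z': "z' \<in> carrier G" "x' = h z'" using assms by blast
    have "h (z \<otimes> z') = x \<otimes>\<^bsub>H\<^esub> x'" using z z' by simp
    then show "{y \<in> carrier G. h y = x \<otimes>\<^bsub>H\<^esub> x'} =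
        {y \<in> carrier G. h y = x} \<otimes>\<^bsub>G Mod kernel G H h\<^esub> {y \<in> carrier G. h y = x'}"
      using z z' fibre[of "z \<otimes> z'"] by (simp add: fibre N.rcos_sum)
  qed
qed

text \<open>If the cosets are singletons, then they define a homomorphism to \<open>K\<close>, and this factors through the
  quotient by the normal closure of any set on which its value is trivial.\<close>

lemma (in coset_lift) quotient_epi:
  assumes N: "N = {\<one>\<^bsub>K\<^esub>}" and onto: "\<Union>(l ` carrier M) = C"
    and S: "S \<subseteq> carrier M" "\<And>s. s \<in> S \<Longrightarrow> \<one>\<^bsub>K\<^esub> \<in> l s"
  shows "\<exists>\<phi>. \<phi> \<in> epi (M Mod normal_closure M S) (K\<lparr>carrier := C\<rparr>)"
proof -
  define h where "h m = the_elem (l m)" for m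
  have single: "l m = {h m}" "h m \<in> carrier K" if m: "m \<in> carrier M" for m
  proof -
    obtain u where u: "u \<in> l m" using value_exists[OF m] .
    have "l m = {u}" using value_eq[OF m u] by (simp add: N r_coset_def)
    then show "l m = {h m}" "h m \<in> carrier K" using value_eq(1)[OF m u] by (simp_all add: h_def)
  qed
  interpret C: subgroup C K using values_subgroup onto by simp
  let ?C = "K\<lparr>carrier := C\<rparr>"
  have C: "C = h ` carrier M" using onto single by auto
  have "h \<in> hom M ?C"
  proof (rule homI)
    fix m m' assume m: "m \<in> carrier M" and m': "m' \<in> carrier M"
    show "h m \<in> carrier ?C" using m C by simp
    show "h (m \<otimes>\<^bsub>M\<^esub> m') = h m \<otimes>\<^bsub>?C\<^esub> h m'"
      using value_mult[OF m _ m', of "h m" "h m'"] single m m' by simp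
  qed
  then interpret h: group_hom M ?C h
    using K.subgroup_imp_group[OF C.subgroup_axioms] M.group_axioms
    by (simp add: group_hom_def group_hom_axioms_def)
  have "h s = \<one>\<^bsub>K\<^esub>" if "s \<in> S" for s
    using S(2)[OF that] single(1)[of s] S(1) that by auto
  then have "S \<subseteq> kernel M ?C h"
    using S(1) unfolding kernel_def by auto
  then have ker: "normal_closure M S \<subseteq> kernel M ?C h" by (rule h.normal_closure_in_kernel)
  note nc = M.normal_closure_normal[OF S(1)]
  let ?\<phi> = "\<lambda>A. the_elem (h ` A)"
  have "?\<phi> ` carrier (M Mod normal_closure M S) = C"
    unfolding carrier_FactGroup image_image C
    by (rule image_cong) (simp_all add: h.the_elem_image_rcoset[OF nc ker])
  then have "?\<phi> \<in> epi (M Mod normal_closure M S) ?C"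
    using h.quotient_hom[OF nc ker] by (simp add: epi_def)
  then show ?thesis by blast
qed

section \<open>Lifting iterated commutators along the extension\<close>

locale group_extension_lift =
  \<Gamma>: group \<Gamma> + p: group_hom Gt G p
  for \<Gamma> :: "'c monoid" and G :: "'a monoid" and Gt :: "'b monoid" and p +
  fixes f :: "'c \<Rightarrow> 'a" and ft :: "'c \<Rightarrow> 'b"
  assumes f_hom: "f \<in> hom \<Gamma> G" and ft_hom: "ft \<in> hom \<Gamma> Gt"
    and p_onto: "p ` carrier Gt = carrier G"
    and p_ft: "x \<in> carrier \<Gamma> \<Longrightarrow> p (ft x) = f x"
begin

abbreviation fibre :: "'a \<Rightarrow> 'b set" where
  "fibre x \<equiv> {y \<in> carrier Gt. p y = x}"

lemma coset_lift_fibre: "coset_lift G (kernel Gt G p) Gt fibre"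
  using p.fibre_lift[OF p_onto] p.normal_kernel p.H.group_axioms
  by (simp add: coset_lift_def coset_lift_axioms_def)

lemma union_fibres: "\<Union>(fibre ` carrier G) = carrier Gt"
  by auto

text \<open>Each value of \<open>l\<close> at \<open>m\<close> is to be a product of \<open>n\<close>-fold commutators in \<open>Gt\<close> that lies over
  \<open>tens_lam G n m\<close>, as if the entries had been lifted along \<open>p\<close>. The compatibility with \<open>p\<close> and with the actions is what
  the relations of the next tensor product require. The last clause says that on elements that
  come from \<open>\<Gamma>\<close> the entries may be lifted through \<open>ft\<close>; it shows in the end that \<open>l\<close> is trivial on
  the image of the kernel of \<open>tens_lam \<Gamma> n\<close>.\<close>

definition tens_coset_lift :: "nat \<Rightarrow> 'b set \<Rightarrow> ('a tpow \<Rightarrow> 'b set) \<Rightarrow> bool" where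
  "tens_coset_lift n N l \<longleftrightarrow>
     coset_lift (tens_pow G n) N Gt l \<and>
     \<Union>(l ` carrier (tens_pow G n)) = lower_central Gt n \<and>
     (\<forall>m\<in>carrier (tens_pow G n). \<forall>u\<in>l m. p u = tens_lam G n m) \<and>
     (\<forall>m\<in>carrier (tens_pow G n). \<forall>u\<in>l m. \<forall>y\<in>carrier Gt.
        conj_by Gt y u \<in> l (tens_act G n (p y) m)) \<and>
     (\<forall>t\<in>carrier (tens_pow \<Gamma> n). ft (tens_lam \<Gamma> n t) \<in> l (tens_map \<Gamma> G f n t))"

text \<open>The first tensor power is \<open>G\<close> itself, and \<open>l\<close> takes an element to its fibre under \<open>p\<close>. So the ambiguity
  is the whole kernel of \<open>p\<close>.\<close>

lemma tens_coset_lift_one: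
  "tens_coset_lift (Suc 0) (kernel Gt G p) (\<lambda>t. fibre (inv_into (carrier G) TBase t))"
proof -
  have "group (tens_pow G (Suc 0))" "tens_lam G (Suc 0) \<in> hom (tens_pow G (Suc 0)) G"
    using tens_pow_precrossed[OF p.H.group_axioms, of 0] by (simp_all add: precrossed_def)
  then have "coset_lift (tens_pow G (Suc 0)) (kernel Gt G p) Gt
      (\<lambda>t. fibre (inv_into (carrier G) TBase t))"
    using coset_lift.precompose[OF coset_lift_fibre] by simp
  then show ?thesis
    using hom_in_carrier[OF f_hom] hom_in_carrier[OF ft_hom] p_ft union_fibres
    by (auto simp: tens_coset_lift_def image_group_carrier inv_into_f_f[OF inj_TBase]
        hom_conj_by[OF p.homh p.G.group_axioms p.H.group_axioms])
qed

text \<open>The step sends \<open>m \<otimes> x\<close> to the commutator of a value of \<open>l\<close> at \<open>m\<close> and an element of the fibre over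
  \<open>x\<close>. The first entry is known modulo \<open>N\<close> and the second one modulo the kernel of \<open>p\<close>, which is why
  both have to be controlled by \<open>P\<close>. All clauses for the new map are checked on the generators.\<close>

lemma tens_coset_lift_Suc:
  assumes l: "tens_coset_lift (Suc k) N l"
    and P: "P \<lhd> Gt" "P \<subseteq> lower_central Gt (Suc (Suc k))" "P \<subseteq> kernel Gt G p"
    and left: "\<And>e y. \<lbrakk>e \<in> N; y \<in> carrier Gt\<rbrakk> \<Longrightarrow> commutator Gt e y \<in> P"
    and right: "\<And>u e. \<lbrakk>u \<in> lower_central Gt (Suc k); e \<in> kernel Gt G p\<rbrakk> \<Longrightarrow> commutator Gt u e \<in> P"
  shows "\<exists>h. tens_coset_lift (Suc (Suc k)) P h"
proof -
  let ?M = "tens_pow G (Suc k)" and ?T = "tens_pow G (Suc (Suc k))"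
  let ?s = "tens_pow_sym G (Suc k)" and ?lam = "tens_lam G (Suc k)" and ?act = "tens_act G (Suc k)"
  let ?lam' = "tens_lam G (Suc (Suc k))" and ?act' = "tens_act G (Suc (Suc k))"
  note G = p.H.group_axioms and \<Gamma> = \<Gamma>.group_axioms
  note pc = tens_pow_precrossed[OF G, of k] and pc' = tens_pow_precrossed[OF G, of "Suc k"]
  note pc\<Gamma> = tens_pow_precrossed[OF \<Gamma>, of k]
  have lift: "coset_lift ?M N Gt l"
    and onto: "\<Union>(l ` carrier ?M) = lower_central Gt (Suc k)"
    and p_l: "\<And>m u. \<lbrakk>m \<in> carrier ?M; u \<in> l m\<rbrakk> \<Longrightarrow> p u = ?lam m"
    and conj_l: "\<And>m u y. \<lbrakk>m \<in> carrier ?M; u \<in> l m; y \<in> carrier Gt\<rbrakk>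
      \<Longrightarrow> conj_by Gt y u \<in> l (?act (p y) m)"
    and ft_l: "\<And>t. t \<in> carrier (tens_pow \<Gamma> (Suc k)) \<Longrightarrow>
      ft (tens_lam \<Gamma> (Suc k) t) \<in> l (tens_map \<Gamma> G f (Suc k) t)"
    using l unfolding tens_coset_lift_def by blast+
  have in_lower: "u \<in> lower_central Gt (Suc k)" if "m \<in> carrier ?M" "u \<in> l m" for m u
    using onto that by blast
  interpret B: coset_pairing ?M G N "kernel Gt G p" P Gt l fibre
    using lift coset_lift_fibre P(1) left right in_lower
    by (simp add: coset_pairing_def coset_pairing_axioms_def)
  have pairing: "tens_pow_pairing G (Suc k) (Gt Mod P) B.pairing"
  proof (rule B.pairing_tensor)
    fix m x assume m: "m \<in> carrier ?M" and x: "x \<in> carrier G"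
    show "conj_by G (?lam m) x \<in> carrier G" "?act x m \<in> carrier ?M"
      using tens_step_actions_closed[OF G pc] m x by auto
    fix u y assume u: "u \<in> l m" and y: "y \<in> fibre x"
    show "conj_by Gt u y \<in> fibre (conj_by G (?lam m) x)"
      using B.X.value_eq(1)[OF m u] y p_l[OF m u]
      by (simp add: hom_conj_by[OF p.homh p.G.group_axioms G])
    show "conj_by Gt y u \<in> l (?act x m)" using conj_l[OF m u] y by auto
  qed
  let ?h = "tens_pow_lift G (Suc k) (Gt Mod P) B.pairing"
  have h_sym: "?h (?s m x) = B.pairing m x" if "m \<in> carrier ?M" "x \<in> carrier G" for m x
    using tens_pow_lift_sym[OF G pc B.P.factorgroup_is_group pairing that] .
  have T: "coset_lift ?T P Gt ?h"
    using tens_pow_lift_hom[OF G pc B.P.factorgroup_is_group pairing] tens_pow_Suc_group[of G k] P(1)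
    by (simp only: coset_lift_def coset_lift_axioms_def)
  then interpret T: coset_lift ?T P Gt ?h .
  note gen = tens_pow_generated[OF G pc] and s_closed = tens_pow_sym_closed[OF G pc]
  have gens: "{?s m x |m x. m \<in> carrier ?M \<and> x \<in> carrier G} \<subseteq> carrier ?T"
    using s_closed by blast
  have "\<Union>(?h ` carrier ?T) = lower_central Gt (Suc (Suc k))"
    using B.values_eq_generate[OF T gen s_closed h_sym] P(2) onto union_fibres by simp
  moreover
  have lam_step_hom: "?lam' \<in> hom ?T G"
    and act_hom: "\<And>g. g \<in> carrier G \<Longrightarrow> ?act' g \<in> hom ?T ?T"
    using pc' by (simp_all only: precrossed_def)
  interpret lam: group_hom ?T G ?lam'
    using lam_step_hom G T.M.group_axioms by (simp only: group_hom_def group_hom_axioms_def)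
  have act: "group_hom ?T ?T (?act' (p y))" if "y \<in> carrier Gt" for y
    using act_hom[of "p y"] that T.M.group_axioms p.hom_closed
    by (simp only: group_hom_def group_hom_axioms_def)
  have compat: "\<exists>u\<in>?h t. p u = ?lam' t \<and> (\<forall>y\<in>carrier Gt. conj_by Gt y u \<in> ?h (?act' (p y) t))"
    if t: "t \<in> carrier ?T" for t
  proof (rule T.generated_value[OF gen gens _ _ _ _ t, where R = "\<lambda>t u. p u = ?lam' t \<and>
        (\<forall>y\<in>carrier Gt. conj_by Gt y u \<in> ?h (?act' (p y) t))"])
    fix r assume "r \<in> {?s m x |m x. m \<in> carrier ?M \<and> x \<in> carrier G}"
    then obtain m x where m: "m \<in> carrier ?M" and x: "x \<in> carrier G" and r: "r = ?s m x" by blast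
    obtain u where u: "u \<in> l m" using B.X.value_exists[OF m] .
    obtain z where z: "z \<in> fibre x" using B.Y.value_exists[OF x] .
    note uc = B.X.value_eq(1)[OF m u]
    have zc: "z \<in> carrier Gt" "p z = x" using z by auto
    have "conj_by Gt y (commutator Gt u z) \<in> ?h (?act' (p y) r)" if y: "y \<in> carrier Gt" for y
    proof -
      have py: "p y \<in> carrier G" using y by simp
      have am: "?act (p y) m \<in> carrier ?M" using tens_step_actions_closed(2)[OF G pc m py] .
      have cx: "conj_by G (p y) x \<in> carrier G" using x py by simp
      have "conj_by Gt y z \<in> fibre (conj_by G (p y) x)"
        using y zc by (simp add: hom_conj_by[OF p.homh p.G.group_axioms G])
      then have "commutator Gt (conj_by Gt y u) (conj_by Gt y z) \<in>
          ?h (?s (?act (p y) m) (conj_by G (p y) x))"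
        using B.commutator_mem_pairing[OF am conj_l[OF m u y] cx] h_sym[OF am cx] by simp
      then show ?thesis
        using y uc zc by (simp only: r tens_act_sym[OF G pc py m x] p.G.conj_by_commutator)
    qed
    moreover have "p (commutator Gt u z) = ?lam' r"
      using uc zc p_l[OF m u]
      by (simp only: r tens_lam_sym[OF G pc m x] hom_commutator[OF p.homh p.G.group_axioms G])
    moreover have "commutator Gt u z \<in> ?h r"
      using B.commutator_mem_pairing[OF m u x z] h_sym[OF m x] r by simp
    ultimately show "\<exists>u\<in>?h r. p u = ?lam' r \<and> (\<forall>y\<in>carrier Gt. conj_by Gt y u \<in> ?h (?act' (p y) r))"
      by blast
  next
    show "p \<one>\<^bsub>Gt\<^esub> = ?lam' \<one>\<^bsub>?T\<^esub> \<and> (\<forall>y\<in>carrier Gt. conj_by Gt y \<one>\<^bsub>Gt\<^esub> \<in> ?h (?act' (p y) \<one>\<^bsub>?T\<^esub>))"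
    proof (intro conjI ballI)
      show "p \<one>\<^bsub>Gt\<^esub> = ?lam' \<one>\<^bsub>?T\<^esub>" by (simp only: p.hom_one lam.hom_one)
      fix y assume y: "y \<in> carrier Gt"
      then have "conj_by Gt y \<one>\<^bsub>Gt\<^esub> = \<one>\<^bsub>Gt\<^esub>" by (simp add: conj_by_def)
      then show "conj_by Gt y \<one>\<^bsub>Gt\<^esub> \<in> ?h (?act' (p y) \<one>\<^bsub>?T\<^esub>)"
        using group_hom.hom_one[OF act[OF y]] T.value_one subgroup.one_closed[OF B.P.is_subgroup]
        by simp
    qed
  next
    fix m u assume m: "m \<in> carrier ?T" and u: "u \<in> ?h m"
      and R: "p u = ?lam' m \<and> (\<forall>y\<in>carrier Gt. conj_by Gt y u \<in> ?h (?act' (p y) m))"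
    note uc = T.value_eq(1)[OF m u]
    show "p (inv\<^bsub>Gt\<^esub> u) = ?lam' (inv\<^bsub>?T\<^esub> m) \<and>
        (\<forall>y\<in>carrier Gt. conj_by Gt y (inv\<^bsub>Gt\<^esub> u) \<in> ?h (?act' (p y) (inv\<^bsub>?T\<^esub> m)))"
    proof (intro conjI ballI)
      show "p (inv\<^bsub>Gt\<^esub> u) = ?lam' (inv\<^bsub>?T\<^esub> m)"
        using R by (simp only: p.hom_inv[OF uc] lam.hom_inv[OF m])
      fix y assume y: "y \<in> carrier Gt"
      have "inv\<^bsub>Gt\<^esub> (conj_by Gt y u) \<in> ?h (inv\<^bsub>?T\<^esub> (?act' (p y) m))"
        using T.value_inv R y group_hom.hom_closed[OF act[OF y] m] by blast
      moreover have "inv\<^bsub>Gt\<^esub> (conj_by Gt y u) = conj_by Gt y (inv\<^bsub>Gt\<^esub> u)"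
        using uc y by (simp add: p.G.word_simps)
      ultimately show "conj_by Gt y (inv\<^bsub>Gt\<^esub> u) \<in> ?h (?act' (p y) (inv\<^bsub>?T\<^esub> m))"
        by (simp only: group_hom.hom_inv[OF act[OF y] m])
    qed
  next
    fix m u m' u' assume m: "m \<in> carrier ?T" and u: "u \<in> ?h m"
      and R: "p u = ?lam' m \<and> (\<forall>y\<in>carrier Gt. conj_by Gt y u \<in> ?h (?act' (p y) m))"
      and m': "m' \<in> carrier ?T" and u': "u' \<in> ?h m'"
      and R': "p u' = ?lam' m' \<and> (\<forall>y\<in>carrier Gt. conj_by Gt y u' \<in> ?h (?act' (p y) m'))"
    note uc = T.value_eq(1)[OF m u] and uc' = T.value_eq(1)[OF m' u']
    show "p (u \<otimes>\<^bsub>Gt\<^esub> u') = ?lam' (m \<otimes>\<^bsub>?T\<^esub> m') \<and>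
        (\<forall>y\<in>carrier Gt. conj_by Gt y (u \<otimes>\<^bsub>Gt\<^esub> u') \<in> ?h (?act' (p y) (m \<otimes>\<^bsub>?T\<^esub> m')))"
    proof (intro conjI ballI)
      show "p (u \<otimes>\<^bsub>Gt\<^esub> u') = ?lam' (m \<otimes>\<^bsub>?T\<^esub> m')"
        using R R' by (simp only: p.hom_mult[OF uc uc'] lam.hom_mult[OF m m'])
      fix y assume y: "y \<in> carrier Gt"
      note actc = group_hom.hom_closed[OF act[OF y]]
      have "conj_by Gt y u \<otimes>\<^bsub>Gt\<^esub> conj_by Gt y u' \<in> ?h (?act' (p y) m \<otimes>\<^bsub>?T\<^esub> ?act' (p y) m')"
        using T.value_mult[OF actc[OF m] _ actc[OF m']] R R' y by blast
      then show "conj_by Gt y (u \<otimes>\<^bsub>Gt\<^esub> u') \<in> ?h (?act' (p y) (m \<otimes>\<^bsub>?T\<^esub> m'))"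
        by (simp only: group_hom.hom_mult[OF act[OF y] m m'] p.G.conj_by_mult[OF y uc uc'])
    qed
  qed
  \<comment> \<open>From one value to all of them: two values differ by an element of \<open>P\<close>, and \<open>p\<close> kills \<open>P\<close>.\<close>
  have "p u = ?lam' t \<and> (\<forall>y\<in>carrier Gt. conj_by Gt y u \<in> ?h (?act' (p y) t))"
    if t: "t \<in> carrier ?T" and u: "u \<in> ?h t" for t u
  proof -
    obtain v where v: "v \<in> ?h t" "p v = ?lam' t"
      "\<And>y. y \<in> carrier Gt \<Longrightarrow> conj_by Gt y v \<in> ?h (?act' (p y) t)"
      using compat[OF t] by blast
    note uc = T.value_eq(1)[OF t u] and vc = T.value_eq[OF t v(1)]
    have uv: "u \<in> P #>\<^bsub>Gt\<^esub> v" using u vc(2) by simp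
    then obtain e where e: "e \<in> P" "u = e \<otimes>\<^bsub>Gt\<^esub> v" by (auto simp: r_coset_def)
    have "p e = \<one>\<^bsub>G\<^esub>" using e(1) P(3) unfolding kernel_def by blast
    then have "p u = p v"
      using p.hom_mult[OF B.P.mem_carrier[OF e(1)] vc(1)] p.hom_closed[OF vc(1)] e(2)
      by (simp only: p.H.l_one)
    moreover have "conj_by Gt y u \<in> ?h (?act' (p y) t)" if y: "y \<in> carrier Gt" for y
    proof -
      have "?act' (p y) t \<in> carrier ?T" using group_hom.hom_closed[OF act[OF y] t] .
      then have "?h (?act' (p y) t) = P #>\<^bsub>Gt\<^esub> conj_by Gt y v"
        using T.value_eq(2) v(3)[OF y] by blast
      then show ?thesis using B.P.conj_by_rcoset[OF y vc(1) uv] by simp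
    qed
    ultimately show ?thesis using v(2) by simp
  qed
  moreover
  have "ft (tens_lam \<Gamma> (Suc (Suc k)) t) \<in> ?h (tens_map \<Gamma> G f (Suc (Suc k)) t)"
    if t: "t \<in> carrier (tens_pow \<Gamma> (Suc (Suc k)))" for t
  proof -
    let ?T\<Gamma> = "tens_pow \<Gamma> (Suc (Suc k))" and ?M\<Gamma> = "tens_pow \<Gamma> (Suc k)"
    let ?s\<Gamma> = "tens_pow_sym \<Gamma> (Suc k)" and ?q = "\<lambda>t. ft (tens_lam \<Gamma> (Suc (Suc k)) t)"
    have map: "tens_map \<Gamma> G f (Suc (Suc k)) \<in> hom ?T\<Gamma> ?T" by (rule tens_map_hom[OF \<Gamma> G f_hom])
    interpret S: coset_lift ?T\<Gamma> P Gt "\<lambda>t. ?h (tens_map \<Gamma> G f (Suc (Suc k)) t)"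
      by (rule T.precompose[OF tens_pow_Suc_group map])
    have "?q \<in> hom ?T\<Gamma> Gt"
      using hom_compose[OF tens_lam_Suc_hom[OF \<Gamma> pc\<Gamma>] ft_hom] by (simp only: comp_def)
    then interpret q: group_hom ?T\<Gamma> Gt ?q
      using S.M.group_axioms p.G.group_axioms by (simp only: group_hom_def group_hom_axioms_def)
    have "\<exists>u\<in>?h (tens_map \<Gamma> G f (Suc (Suc k)) t). u = ?q t"
    proof (rule S.generated_value[OF tens_pow_generated[OF \<Gamma> pc\<Gamma>] _ _ _ _ _ t,
          where R = "\<lambda>t u. u = ?q t"])
      show "{?s\<Gamma> m x |m x. m \<in> carrier ?M\<Gamma> \<and> x \<in> carrier \<Gamma>} \<subseteq> carrier ?T\<Gamma>"
        using tens_pow_sym_closed[OF \<Gamma> pc\<Gamma>] by blast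
      fix r assume "r \<in> {?s\<Gamma> m x |m x. m \<in> carrier ?M\<Gamma> \<and> x \<in> carrier \<Gamma>}"
      then obtain m x where m: "m \<in> carrier ?M\<Gamma>" and x: "x \<in> carrier \<Gamma>" and r: "r = ?s\<Gamma> m x"
        by blast
      have fm: "tens_map \<Gamma> G f (Suc k) m \<in> carrier ?M"
        using hom_in_carrier[OF tens_map_hom[OF \<Gamma> G f_hom] m] .
      have fx: "f x \<in> carrier G" using hom_in_carrier[OF f_hom x] .
      have "ft x \<in> fibre (f x)" using hom_in_carrier[OF ft_hom x] p_ft[OF x] by simp
      then have "commutator Gt (ft (tens_lam \<Gamma> (Suc k) m)) (ft x) \<in>
          ?h (?s (tens_map \<Gamma> G f (Suc k) m) (f x))"
        using B.commutator_mem_pairing[OF fm ft_l[OF m] fx] h_sym[OF fm fx] by simp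
      moreover have "commutator Gt (ft (tens_lam \<Gamma> (Suc k) m)) (ft x) = ?q r"
        using hom_in_carrier[OF lam_hom[OF \<Gamma> pc\<Gamma>] m] x
        by (simp only: r tens_lam_sym[OF \<Gamma> pc\<Gamma> m x]
            hom_commutator[OF ft_hom \<Gamma> p.G.group_axioms])
      ultimately show "\<exists>u\<in>?h (tens_map \<Gamma> G f (Suc (Suc k)) r). u = ?q r"
        by (simp only: r tens_map_sym[OF \<Gamma> G f_hom m x]) blast
    qed (simp_all only: q.hom_one q.hom_inv q.hom_mult)
    then show ?thesis by blast
  qed
  ultimately show ?thesis using T unfolding tens_coset_lift_def by blast
qed

definition ext_coset_lift :: "nat \<Rightarrow> 'b set \<Rightarrow> ('a epow \<Rightarrow> 'b set) \<Rightarrow> bool" where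
  "ext_coset_lift n N l \<longleftrightarrow>
     coset_lift (ext_pow G n) N Gt l \<and>
     \<Union>(l ` carrier (ext_pow G n)) = derived_series Gt n \<and>
     (\<forall>t\<in>carrier (ext_pow \<Gamma> n). ft (ext_mu \<Gamma> n t) \<in> l (ext_map \<Gamma> G f n t))"

lemma ext_coset_lift_one:
  "ext_coset_lift (Suc 0) (kernel Gt G p) (\<lambda>t. fibre (inv_into (carrier G) EBase t))"
proof -
  have "coset_lift (ext_pow G (Suc 0)) (kernel Gt G p) Gt
      (\<lambda>t. fibre (inv_into (carrier G) EBase t))"
    using coset_lift.precompose[OF coset_lift_fibre ext_pow_group[OF p.H.group_axioms]
        ext_mu_hom[OF p.H.group_axioms], of 0] by simp
  then show ?thesis
    using hom_in_carrier[OF f_hom] hom_in_carrier[OF ft_hom] p_ft union_fibres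
    by (auto simp: ext_coset_lift_def image_group_carrier inv_into_f_f[OF inj_EBase]
        derived_series_def)
qed

text \<open>Both entries of \<open>[u, v]\<close> are now known modulo \<open>N\<close>, and they lie in the derived series. So only the
  commutators of \<open>N\<close> with a term of that series have to fall into \<open>P\<close>. The diagonal is killed because
  \<open>[u, u] = 1\<close>.\<close>

lemma ext_coset_lift_Suc:
  assumes l: "ext_coset_lift (Suc k) N l"
    and P: "P \<lhd> Gt" "P \<subseteq> derived_series Gt (Suc (Suc k))"
    and left: "\<And>e y. \<lbrakk>e \<in> N; y \<in> derived_series Gt (Suc k)\<rbrakk> \<Longrightarrow> commutator Gt e y \<in> P"
  shows "\<exists>h. ext_coset_lift (Suc (Suc k)) P h"
proof -
  let ?M = "ext_pow G (Suc k)" and ?T = "ext_pow G (Suc (Suc k))"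
  let ?s = "ext_pow_sym G (Suc k)"
  note G = p.H.group_axioms and \<Gamma> = \<Gamma>.group_axioms
  have lift: "coset_lift ?M N Gt l"
    and onto: "\<Union>(l ` carrier ?M) = derived_series Gt (Suc k)"
    and ft_l: "\<And>t. t \<in> carrier (ext_pow \<Gamma> (Suc k)) \<Longrightarrow>
      ft (ext_mu \<Gamma> (Suc k) t) \<in> l (ext_map \<Gamma> G f (Suc k) t)"
    using l unfolding ext_coset_lift_def by blast+
  interpret L: coset_lift ?M N Gt l by (rule lift)
  have in_derived: "u \<in> derived_series Gt (Suc k)" if "m \<in> carrier ?M" "u \<in> l m" for m u
    using onto that by blast
  have right: "commutator Gt u e \<in> P" if m: "m \<in> carrier ?M" "u \<in> l m" and e: "e \<in> N" for m u e
    using normal.commutator_mem_swap[OF P(1)] left[OF e in_derived[OF m]] L.value_eq(1)[OF m]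
      L.K.mem_carrier[OF e] by blast
  interpret B: coset_pairing ?M ?M N N P Gt l l
    using lift P(1) left right in_derived
    by (simp add: coset_pairing_def coset_pairing_axioms_def)
  have pairing: "wedge_pairing ?M (Gt Mod P) B.pairing"
    unfolding wedge_pairing_def
  proof (intro conjI ballI)
    show "tensor_pairing ?M ?M (conj_by ?M) (conj_by ?M) (Gt Mod P) B.pairing"
      by (rule B.pairing_tensor) (use L.value_conj_by L.M.conj_by_closed in auto)
    fix m assume m: "m \<in> carrier ?M"
    obtain u where u: "u \<in> l m" using L.value_exists[OF m] .
    have "B.pairing m m = P #>\<^bsub>Gt\<^esub> commutator Gt u u" by (rule B.pairing_eq[OF m u m u])
    also have "\<dots> = P"
      using L.value_eq(1)[OF m u] B.P.subset by (simp add: p.G.commutator_self)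
    finally show "B.pairing m m = \<one>\<^bsub>Gt Mod P\<^esub>" by simp
  qed
  let ?h = "ext_pow_lift G (Suc k) (Gt Mod P) B.pairing"
  have h_sym: "?h (?s m x) = B.pairing m x" if "m \<in> carrier ?M" "x \<in> carrier ?M" for m x
    using ext_pow_lift_sym[OF G B.P.factorgroup_is_group pairing that] .
  have T: "coset_lift ?T P Gt ?h"
    using ext_pow_lift_hom[OF G B.P.factorgroup_is_group pairing] ext_pow_group[OF G, of "Suc k"] P(1)
    by (simp only: coset_lift_def coset_lift_axioms_def)
  then interpret T: coset_lift ?T P Gt ?h .
  note gen = ext_pow_generated[OF G, of k] and s_closed = ext_pow_sym_closed[OF G]
  have "\<Union>(?h ` carrier ?T) = derived_series Gt (Suc (Suc k))"
    using B.values_eq_generate[OF T gen s_closed h_sym] P(2) onto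
    by (simp only: derived_series_Suc_Suc)
  moreover
  have "ft (ext_mu \<Gamma> (Suc (Suc k)) t) \<in> ?h (ext_map \<Gamma> G f (Suc (Suc k)) t)"
    if t: "t \<in> carrier (ext_pow \<Gamma> (Suc (Suc k)))" for t
  proof -
    let ?T\<Gamma> = "ext_pow \<Gamma> (Suc (Suc k))" and ?M\<Gamma> = "ext_pow \<Gamma> (Suc k)"
    let ?s\<Gamma> = "ext_pow_sym \<Gamma> (Suc k)" and ?q = "\<lambda>t. ft (ext_mu \<Gamma> (Suc (Suc k)) t)"
    have map: "ext_map \<Gamma> G f (Suc (Suc k)) \<in> hom ?T\<Gamma> ?T" by (rule ext_map_hom[OF \<Gamma> G f_hom])
    interpret S: coset_lift ?T\<Gamma> P Gt "\<lambda>t. ?h (ext_map \<Gamma> G f (Suc (Suc k)) t)"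
      by (rule T.precompose[OF ext_pow_group[OF \<Gamma>] map])
    have "?q \<in> hom ?T\<Gamma> Gt"
      using hom_compose[OF ext_mu_hom[OF \<Gamma>] ft_hom] by (simp only: comp_def)
    then interpret q: group_hom ?T\<Gamma> Gt ?q
      using S.M.group_axioms p.G.group_axioms by (simp only: group_hom_def group_hom_axioms_def)
    have "\<exists>u\<in>?h (ext_map \<Gamma> G f (Suc (Suc k)) t). u = ?q t"
    proof (rule S.generated_value[OF ext_pow_generated[OF \<Gamma>] _ _ _ _ _ t,
          where R = "\<lambda>t u. u = ?q t"])
      show "{?s\<Gamma> m x |m x. m \<in> carrier ?M\<Gamma> \<and> x \<in> carrier ?M\<Gamma>} \<subseteq> carrier ?T\<Gamma>"
        using ext_pow_sym_closed[OF \<Gamma>] by blast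
      fix r assume "r \<in> {?s\<Gamma> m x |m x. m \<in> carrier ?M\<Gamma> \<and> x \<in> carrier ?M\<Gamma>}"
      then obtain m x where m: "m \<in> carrier ?M\<Gamma>" and x: "x \<in> carrier ?M\<Gamma>" and r: "r = ?s\<Gamma> m x"
        by blast
      note map_closed = hom_in_carrier[OF ext_map_hom[OF \<Gamma> G f_hom, of k]]
      note mu_closed = hom_in_carrier[OF ext_mu_hom[OF \<Gamma>, of k]]
      have "commutator Gt (ft (ext_mu \<Gamma> (Suc k) m)) (ft (ext_mu \<Gamma> (Suc k) x)) \<in>
          ?h (?s (ext_map \<Gamma> G f (Suc k) m) (ext_map \<Gamma> G f (Suc k) x))"
        using B.commutator_mem_pairing[OF map_closed[OF m] ft_l[OF m] map_closed[OF x] ft_l[OF x]]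
          h_sym[OF map_closed[OF m] map_closed[OF x]] by simp
      moreover have "commutator Gt (ft (ext_mu \<Gamma> (Suc k) m)) (ft (ext_mu \<Gamma> (Suc k) x)) = ?q r"
        using mu_closed[OF m] mu_closed[OF x]
        by (simp only: r ext_mu_sym[OF \<Gamma> m x] hom_commutator[OF ft_hom \<Gamma> p.G.group_axioms])
      ultimately show "\<exists>u\<in>?h (ext_map \<Gamma> G f (Suc (Suc k)) r). u = ?q r"
        by (simp only: r ext_map_sym[OF \<Gamma> G f_hom m x]) blast
    qed (simp_all only: q.hom_one q.hom_inv q.hom_mult)
    then show ?thesis by blast
  qed
  ultimately show ?thesis using T unfolding ext_coset_lift_def by blast
qed

lemma one_mem_lift_of_kernel:
  assumes "\<forall>t\<in>carrier T. ft (\<mu> t) \<in> l (h t)" "s \<in> h ` kernel T \<Gamma> \<mu>"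
  shows "\<one>\<^bsub>Gt\<^esub> \<in> l s"
proof -
  obtain t where t: "t \<in> carrier T" "\<mu> t = \<one>\<^bsub>\<Gamma>\<^esub>" "s = h t"
    using assms(2) by (auto simp: kernel_def)
  have "ft \<one>\<^bsub>\<Gamma>\<^esub> = \<one>\<^bsub>Gt\<^esub>" by (rule hom_one[OF ft_hom \<Gamma>.group_axioms p.G.group_axioms])
  then show ?thesis using assms(1) t by metis
qed

text \<open>The ambiguity is at each stage contained in a term of the upper central series whose index drops by
  one with every new entry. It starts with the kernel of \<open>p\<close> inside \<open>Z\<^sub>n\<close> and ends with \<open>Z\<^sub>0\<close>, which is trivial.\<close>

theorem tens_pow_f_epi:
  assumes "kernel Gt G p \<subseteq> upper_central Gt n"
  shows "\<exists>\<phi>. \<phi> \<in> epi (tens_pow_f \<Gamma> G f (Suc n)) (Gt\<lparr>carrier := lower_central Gt (Suc n)\<rparr>)"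
proof -
  define N where "N k = upper_central Gt (n - k) \<inter> lower_central Gt (Suc k) \<inter> kernel Gt G p" for k
  have "k \<le> n \<Longrightarrow> \<exists>l. tens_coset_lift (Suc k) (N k) l" for k
  proof (induction k)
    case 0
    have "N 0 = kernel Gt G p" using assms by (auto simp: N_def kernel_def)
    then show ?case using tens_coset_lift_one by auto
  next
    case (Suc k)
    then obtain l where l: "tens_coset_lift (Suc k) (N k) l" by auto
    have n: "n - k = Suc (n - Suc k)" "n = (n - Suc k) + Suc k" using Suc.prems by auto
    interpret Ker: normal "kernel Gt G p" Gt by (rule p.normal_kernel)
    show ?case
    proof (rule tens_coset_lift_Suc[OF l])
      show "N (Suc k) \<lhd> Gt"
        unfolding N_def
        by (intro p.G.normal_subgroup_intersect p.G.upper_central_normal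
            p.G.lower_central_normal p.normal_kernel)
      show "N (Suc k) \<subseteq> lower_central Gt (Suc (Suc k))" "N (Suc k) \<subseteq> kernel Gt G p"
        unfolding N_def by blast+
    next
      fix e y assume e: "e \<in> N k" and y: "y \<in> carrier Gt"
      have "commutator Gt e y \<in> upper_central Gt (n - Suc k)"
        using e y upper_centralD[of e Gt "n - Suc k" y] unfolding N_def n(1) by blast
      moreover have "commutator Gt e y \<in> lower_central Gt (Suc (Suc k))"
        using e y unfolding N_def by (auto intro: generate.incl)
      moreover have "commutator Gt e y \<in> kernel Gt G p"
        using e y Ker.commutator_mem unfolding N_def by blast
      ultimately show "commutator Gt e y \<in> N (Suc k)" by (simp only: N_def Int_iff simp_thms)
    next
      fix u e assume u: "u \<in> lower_central Gt (Suc k)" and e: "e \<in> kernel Gt G p"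
      have uc: "u \<in> carrier Gt"
        using u p.G.lower_central_normal normal_imp_subgroup subgroup.mem_carrier by metis
      have "e \<in> upper_central Gt ((n - Suc k) + Suc k)" using e assms n(2) by auto
      then have "commutator Gt u e \<in> upper_central Gt (n - Suc k)"
        by (rule p.G.lower_upper_commutator[OF u])
      moreover have "commutator Gt u e \<in> lower_central Gt (Suc (Suc k))"
        using u Ker.mem_carrier[OF e] by (auto intro: generate.incl)
      moreover have "commutator Gt u e \<in> kernel Gt G p"
        using Ker.commutator_mem_swap Ker.commutator_mem e Ker.mem_carrier[OF e] uc by blast
      ultimately show "commutator Gt u e \<in> N (Suc k)" by (simp only: N_def Int_iff simp_thms)
    qed
  qed
  then obtain l where l: "tens_coset_lift (Suc n) (N n) l" by blast
  then interpret L: coset_lift "tens_pow G (Suc n)" "N n" Gt l by (simp add: tens_coset_lift_def)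
  have "\<one>\<^bsub>Gt\<^esub> \<in> N n" by (rule subgroup.one_closed[OF L.K.is_subgroup])
  then have N: "N n = {\<one>\<^bsub>Gt\<^esub>}" by (auto simp: N_def)
  have S: "tens_map \<Gamma> G f (Suc n) ` kernel (tens_pow \<Gamma> (Suc n)) \<Gamma> (tens_lam \<Gamma> (Suc n))
      \<subseteq> carrier (tens_pow G (Suc n))"
    using hom_in_carrier[OF tens_map_hom[OF \<Gamma>.group_axioms p.H.group_axioms f_hom]]
    unfolding kernel_def by blast
  have onto: "\<Union>(l ` carrier (tens_pow G (Suc n))) = lower_central Gt (Suc n)"
    and ft_l: "\<forall>t\<in>carrier (tens_pow \<Gamma> (Suc n)).
      ft (tens_lam \<Gamma> (Suc n) t) \<in> l (tens_map \<Gamma> G f (Suc n) t)"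
    using l unfolding tens_coset_lift_def by blast+
  show ?thesis
    unfolding tens_pow_f_def
  proof (rule L.quotient_epi[OF N onto S])
    fix s assume "s \<in> tens_map \<Gamma> G f (Suc n) ` kernel (tens_pow \<Gamma> (Suc n)) \<Gamma> (tens_lam \<Gamma> (Suc n))"
    then show "\<one>\<^bsub>Gt\<^esub> \<in> l s"
      using one_mem_lift_of_kernel[where l = l and h = "tens_map \<Gamma> G f (Suc n)"] ft_l by blast
  qed
qed

text \<open>The same with the chain of centralizers of the terms of the derived series: the stage \<open>k\<close> leaves an
  ambiguity that is killed by commuting with elements of \<open>\<Gamma>\<^sub>k, \<dots>, \<Gamma>\<^sub>n\<close> in turn, and after the last
  stage there is nothing left to commute with.\<close>

theorem ext_pow_f_epi:
  assumes "kernel Gt G p \<subseteq> frak_D Gt n"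
  shows "\<exists>\<phi>. \<phi> \<in> epi (ext_pow_f \<Gamma> G f (Suc n)) (Gt\<lparr>carrier := derived_series Gt (Suc n)\<rparr>)"
proof -
  define N where "N k = frak_chain Gt (Suc k) (n - k) \<inter> derived_series Gt (Suc k) \<inter> kernel Gt G p" for k
  have "k \<le> n \<Longrightarrow> \<exists>l. ext_coset_lift (Suc k) (N k) l" for k
  proof (induction k)
    case 0
    have "kernel Gt G p \<subseteq> frak_chain Gt (Suc 0) n"
      using assms p.G.frak_D_subset_frak_chain by blast
    then have "N 0 = kernel Gt G p" by (auto simp: N_def kernel_def derived_series_def)
    then show ?case using ext_coset_lift_one by auto
  next
    case (Suc k)
    then obtain l where l: "ext_coset_lift (Suc k) (N k) l" by auto
    have n: "n - k = Suc (n - Suc k)" using Suc.prems by auto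
    interpret Ker: normal "kernel Gt G p" Gt by (rule p.normal_kernel)
    interpret D: normal "derived_series Gt (Suc k)" Gt by (rule p.G.derived_series_normal)
    show ?case
    proof (rule ext_coset_lift_Suc[OF l])
      show "N (Suc k) \<lhd> Gt"
        unfolding N_def
        by (intro p.G.normal_subgroup_intersect p.G.frak_chain_normal
            p.G.derived_series_normal p.normal_kernel)
      show "N (Suc k) \<subseteq> derived_series Gt (Suc (Suc k))" unfolding N_def by blast
    next
      fix e y assume e: "e \<in> N k" and y: "y \<in> derived_series Gt (Suc k)"
      have "commutator Gt e y \<in> frak_chain Gt (Suc (Suc k)) (n - Suc k)"
        using e y unfolding N_def n frak_chain.simps centralizer_mod_def by blast
      moreover have "commutator Gt e y \<in> derived_series Gt (Suc (Suc k))"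
        using e y unfolding N_def derived_series_Suc_Suc by (auto intro: generate.incl)
      moreover have "commutator Gt e y \<in> kernel Gt G p"
        using e Ker.commutator_mem D.mem_carrier[OF y] unfolding N_def by blast
      ultimately show "commutator Gt e y \<in> N (Suc k)" by (simp only: N_def Int_iff simp_thms)
    qed
  qed
  then obtain l where l: "ext_coset_lift (Suc n) (N n) l" by blast
  then interpret L: coset_lift "ext_pow G (Suc n)" "N n" Gt l by (simp add: ext_coset_lift_def)
  have "\<one>\<^bsub>Gt\<^esub> \<in> N n" by (rule subgroup.one_closed[OF L.K.is_subgroup])
  then have N: "N n = {\<one>\<^bsub>Gt\<^esub>}" by (auto simp: N_def)
  have S: "ext_map \<Gamma> G f (Suc n) ` kernel (ext_pow \<Gamma> (Suc n)) \<Gamma> (ext_mu \<Gamma> (Suc n))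
      \<subseteq> carrier (ext_pow G (Suc n))"
    using hom_in_carrier[OF ext_map_hom[OF \<Gamma>.group_axioms p.H.group_axioms f_hom]]
    unfolding kernel_def by blast
  have onto: "\<Union>(l ` carrier (ext_pow G (Suc n))) = derived_series Gt (Suc n)"
    and ft_l: "\<forall>t\<in>carrier (ext_pow \<Gamma> (Suc n)).
      ft (ext_mu \<Gamma> (Suc n) t) \<in> l (ext_map \<Gamma> G f (Suc n) t)"
    using l unfolding ext_coset_lift_def by blast+
  show ?thesis
    unfolding ext_pow_f_def
  proof (rule L.quotient_epi[OF N onto S])
    fix s assume "s \<in> ext_map \<Gamma> G f (Suc n) ` kernel (ext_pow \<Gamma> (Suc n)) \<Gamma> (ext_mu \<Gamma> (Suc n))"
    then show "\<one>\<^bsub>Gt\<^esub> \<in> l s"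
      using one_mem_lift_of_kernel[where l = l and h = "ext_map \<Gamma> G f (Suc n)"] ft_l by blast
  qed
qed

end

theorem theorem4p2:
  fixes \<Gamma> :: "'c monoid" and G :: "'a monoid" and Gt :: "'b monoid"
    and f :: "'c \<Rightarrow> 'a" and p :: "'b \<Rightarrow> 'a" and n :: nat
  assumes "n \<ge> 2"
    and "group \<Gamma>" and "group G" and "group Gt"
    and "f \<in> hom \<Gamma> G"
    and "f_extension \<Gamma> G f Gt p"
  shows "(kernel Gt G p \<subseteq> upper_central Gt (n - 1) \<longrightarrow>
            (\<exists>\<phi>. \<phi> \<in> epi (tens_pow_f \<Gamma> G f n) (Gt\<lparr>carrier := lower_central Gt n\<rparr>)))
       \<and> (kernel Gt G p \<subseteq> frak_D Gt (n - 1) \<longrightarrow>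
            (\<exists>\<phi>. \<phi> \<in> epi (ext_pow_f \<Gamma> G f n) (Gt\<lparr>carrier := derived_series Gt n\<rparr>)))"
proof -
  obtain ft where p: "p \<in> epi Gt G" and ft: "ft \<in> hom \<Gamma> Gt"
    and p_ft: "\<forall>x\<in>carrier \<Gamma>. p (ft x) = f x"
    using assms(6) unfolding f_extension_def by blast
  interpret group_extension_lift \<Gamma> G Gt p f ft
    using assms(2-5) p ft p_ft
    by (simp add: group_extension_lift_def group_extension_lift_axioms_def group_hom_def
        group_hom_axioms_def epi_def)
  obtain k where n: "n = Suc k" using assms(1) by (cases n) auto
  show ?thesis
    unfolding n diff_Suc_1 by (intro conjI impI tens_pow_f_epi ext_pow_f_epi)
qed

end
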